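(* Let $n\ge2$, $\gamma>0$, $0<\lambda\le\Lambda$, and let $f$ be a locally Dini continuous function of the single variable $x_n\in(0,\infty)$ with values in $[\lambda,\Lambda]$. Consider the problem $$-\Delta u=f(x_n)u^{-\gamma}\ \text{ in }\mathbb{R}^n_+,\qquad u=0\ \text{ on }\partial\mathbb{R}^n_+,$$ where $\mathbb{R}^n_+=\{X=(x',x_n)\in\mathbb{R}^n:x_n>0\}$. (i) If $\gamma>1$, then every global solution $u$ of this problem is one-dimensional, i.e. $u(X)=u(x_n)$ depends only on $x_n$. (ii) If $0<\gamma\le1$, then the problem admits no global solution.
   Context: A global solution means a classical solution: $u\in C^2(\mathbb{R}^n_+)\cap C^0(\overline{\mathbb{R}^n_+})$, $u>0$ in $\mathbb{R}^n_+$, satisfying the equation pointwise and $u=0$ on $\partial\mathbb{R}^n_+$. A function $f$ on $(0,\infty)$ is locally Dini continuous if on every compact subset $E$ it has a modulus of continuity $\omega_E$ with $\int_0^1\omega_E(t)\,\frac{dt}{t}<\infty$. *)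

theory Defs
  imports "HOL-Analysis.Analysis"
begin

text \<open>The index type of \<open>real ^ 'n\<close> is unordered, so a distinguished index \<open>k\<close> plays the role
  of the last coordinate: \<open>X $ k\<close> is \<open>x\<^sub>n\<close>.\<close>

definition half_space :: "'n \<Rightarrow> (real ^ 'n::finite) set" where
  "half_space k = {X. 0 < X $ k}"

definition partial_deriv :: "'n \<Rightarrow> (real ^ 'n::finite \<Rightarrow> real) \<Rightarrow> real ^ 'n \<Rightarrow> real" where
  "partial_deriv i u X = frechet_derivative u (at X) (axis i 1)"

text \<open>The next two predicates use two-sided derivatives and are meant for open sets \<open>S\<close>.\<close>

definition C1_on :: "(real ^ 'n::finite) set \<Rightarrow> (real ^ 'n \<Rightarrow> real) \<Rightarrow> bool" where
  "C1_on S u \<longleftrightarrow> (\<forall>X\<in>S. u differentiable (at X)) \<and> (\<forall>i. continuous_on S (partial_deriv i u))"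

definition C2_on :: "(real ^ 'n::finite) set \<Rightarrow> (real ^ 'n \<Rightarrow> real) \<Rightarrow> bool" where
  "C2_on S u \<longleftrightarrow> C1_on S u \<and> (\<forall>i. C1_on S (partial_deriv i u))"

definition laplacian :: "(real ^ 'n::finite \<Rightarrow> real) \<Rightarrow> real ^ 'n \<Rightarrow> real" where
  "laplacian u X = (\<Sum>i\<in>UNIV. partial_deriv i (partial_deriv i u) X)"

definition modulus_of_continuity :: "(real \<Rightarrow> real) \<Rightarrow> real set \<Rightarrow> (real \<Rightarrow> real) \<Rightarrow> bool" where
  "modulus_of_continuity f E \<omega> \<longleftrightarrow>
     mono_on {0..} \<omega> \<and> \<omega> 0 = 0 \<and> (\<omega> \<longlongrightarrow> 0) (at_right 0) \<and>
     (\<forall>x\<in>E. \<forall>y\<in>E. \<bar>f x - f y\<bar> \<le> \<omega> \<bar>x - y\<bar>)"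

definition locally_Dini_continuous :: "(real \<Rightarrow> real) \<Rightarrow> bool" where
  "locally_Dini_continuous f \<longleftrightarrow>
     (\<forall>E. compact E \<and> E \<subseteq> {0<..} \<longrightarrow>
       (\<exists>\<omega>. modulus_of_continuity f E \<omega> \<and>
            (\<integral>\<^sup>+t\<in>{0<..<1}. ennreal (\<omega> t / t) \<partial>lborel) < \<infinity>))"

text \<open>The values of \<open>u\<close> off the closed half-space and of \<open>f\<close> off \<open>(0, \<infinity>)\<close> play no role.\<close>

definition global_solution ::
  "'n \<Rightarrow> real \<Rightarrow> (real \<Rightarrow> real) \<Rightarrow> (real ^ 'n::finite \<Rightarrow> real) \<Rightarrow> bool" where
  "global_solution k \<gamma> f u \<longleftrightarrow>
     C2_on (half_space k) u \<and>
     continuous_on (closure (half_space k)) u \<and>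
     (\<forall>X\<in>half_space k. 0 < u X) \<and>
     (\<forall>X\<in>half_space k. - laplacian u X = f (X $ k) * u X powr (- \<gamma>)) \<and>
     (\<forall>X\<in>frontier (half_space k). u X = 0)"

definition one_dimensional :: "'n \<Rightarrow> (real ^ 'n::finite \<Rightarrow> real) \<Rightarrow> bool" where
  "one_dimensional k u \<longleftrightarrow> (\<exists>\<phi>. \<forall>X\<in>closure (half_space k). u X = \<phi> (X $ k))"

end

theory Submission
  imports Defs
begin

text \<open>
  Let \<open>u\<close> be a global solution, \<open>h\<close> a tangential vector and \<open>u\<^sub>h = u(\<cdot> + h)\<close>, again a solution. Where
  \<open>u > u\<^sub>h\<close> the difference \<open>u - u\<^sub>h\<close> is subharmonic, so its positive part \<open>w\<close> is subharmonic with zero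
  boundary values. With \<open>c\<close> the infimum of \<open>u / x\<^sub>n\<close>, the function \<open>v = u - c x\<^sub>n\<close> is nonnegative and
  superharmonic, and \<open>w \<le> v\<close> because \<open>u\<^sub>h \<ge> c x\<^sub>n\<close>. Weighted means over half-balls of growing radius
  give \<open>w(X) / x\<^sub>n \<le> C v(Y) / y\<^sub>n\<close> for all \<open>X\<close>, \<open>Y\<close>; the infimum of the right-hand side over \<open>Y\<close> is
  \<open>0\<close>, so \<open>w = 0\<close>, i.e. \<open>u \<le> u\<^sub>h\<close> for every \<open>h\<close>. Hence \<open>u\<close> is one-dimensional, for every \<open>\<gamma> > 0\<close>.

  If \<open>\<gamma> \<le> 1\<close>, the profile \<open>\<phi>\<close> is positive and concave on \<open>(0, \<infinity>)\<close>, so it grows at most linearly and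
  \<open>\<phi>'' \<le> - a / t\<close> for \<open>t \<ge> 1\<close> and some \<open>a > 0\<close>; then \<open>\<phi>'\<close> becomes negative, which is impossible.
\<close>

subsection \<open>Partial derivatives and Green's identity\<close>

text \<open>A derivative along a single coordinate line, so that the product, chain and uniqueness
  rules of one-variable calculus apply as they are.\<close>

definition has_pd :: "'n \<Rightarrow> (real ^ 'n::finite \<Rightarrow> real) \<Rightarrow> real \<Rightarrow> real ^ 'n \<Rightarrow> bool" where
  "has_pd i u d X \<longleftrightarrow> ((\<lambda>t. u (X + t *\<^sub>R axis i 1)) has_real_derivative d) (at 0)"

lemma has_pd_partial_deriv:
  assumes "u differentiable (at X)"
  shows "has_pd i u (partial_deriv i u X) X"
proof -
  have "(u has_derivative frechet_derivative u (at X)) (at (X + 0 *\<^sub>R axis i (1::real)))"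
    using assms frechet_derivative_works by auto
  then have "((\<lambda>t. u (X + t *\<^sub>R axis i 1)) has_derivative
      (\<lambda>t. frechet_derivative u (at X) (t *\<^sub>R axis i 1))) (at 0)"
    by (rule has_derivative_compose[rotated]) (auto intro!: derivative_eq_intros)
  moreover have "frechet_derivative u (at X) (t *\<^sub>R axis i 1) = t * partial_deriv i u X" for t
    using assms linear_frechet_derivative linear_cmul
    unfolding partial_deriv_def by fastforce
  ultimately show ?thesis
    unfolding has_pd_def has_field_derivative_def by (simp add: mult.commute[of _ "partial_deriv i u X"])
qed

lemma has_pd_mult:
  "has_pd i u a X \<Longrightarrow> has_pd i v b X \<Longrightarrow> has_pd i (\<lambda>Z. u Z * v Z) (a * v X + b * u X) X"
  unfolding has_pd_def by (drule (1) DERIV_mult) simp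

lemma has_pd_diff:
  "has_pd i u a X \<Longrightarrow> has_pd i v b X \<Longrightarrow> has_pd i (\<lambda>Z. u Z - v Z) (a - b) X"
  unfolding has_pd_def by (rule DERIV_diff)

lemma has_pd_chain:
  assumes "has_pd i u a X" "(e has_real_derivative d) (at (u X))"
  shows "has_pd i (\<lambda>Z. e (u Z)) (d * a) X"
  using DERIV_chain2[of e d "\<lambda>t. u (X + t *\<^sub>R axis i 1)" 0 a UNIV] assms unfolding has_pd_def by simp

lemma has_pd_nth: "has_pd i (\<lambda>Z. Z $ j) (if j = i then 1 else 0) X"
  unfolding has_pd_def by (auto simp: axis_def intro!: derivative_eq_intros)

lemma has_pd_const: "has_pd i (\<lambda>Z. c) 0 X"
  unfolding has_pd_def by simp

lemma has_pd_shift: "has_pd i u d (X + h) \<Longrightarrow> has_pd i (\<lambda>Z. u (Z + h)) d X"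
  unfolding has_pd_def by (simp add: algebra_simps)

lemma has_pd_transform:
  assumes "has_pd i u d X" "open S" "X \<in> S" "\<And>Z. Z \<in> S \<Longrightarrow> u Z = v Z"
  shows "has_pd i v d X"
proof -
  have "open ((\<lambda>t. X + t *\<^sub>R axis i (1::real)) -` S)"
    by (intro continuous_open_vimage assms continuous_intros)
  then have "\<forall>\<^sub>F t in nhds 0. t \<in> (\<lambda>t. X + t *\<^sub>R axis i (1::real)) -` S"
    by (rule eventually_nhds_in_open) (simp add: assms)
  then have "\<forall>\<^sub>F t in nhds 0. u (X + t *\<^sub>R axis i 1) = v (X + t *\<^sub>R axis i 1)"
    by eventually_elim (simp add: assms)
  from DERIV_cong_ev[OF refl this refl] show ?thesis
    using assms(1) unfolding has_pd_def by simp
qed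

lemma has_pd_unique: "has_pd i u a X \<Longrightarrow> has_pd i u b X \<Longrightarrow> a = b"
  unfolding has_pd_def by (rule DERIV_unique)

lemma has_pd_line:
  assumes "has_pd i u d (X + t *\<^sub>R axis i 1)"
  shows "((\<lambda>t. u (X + t *\<^sub>R axis i 1)) has_real_derivative d) (at t)"
proof -
  have "((\<lambda>s. u (X + (s + t) *\<^sub>R axis i 1)) has_real_derivative d) (at 0)"
    using assms unfolding has_pd_def by (simp add: algebra_simps)
  then show ?thesis
    using DERIV_shift[of "\<lambda>s. u (X + s *\<^sub>R axis i 1)" d 0 t] by simp
qed

text \<open>Translating \<open>F\<close> along the axis does not change its integral over a slightly
  larger box, because the support stays inside that box. Differentiating this constant under the
  integral sign at \<open>t = 0\<close> gives the integral of \<open>F'\<close>.\<close>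

lemma integral_pd_eq_0:
  fixes F F' :: "real ^ 'n::finite \<Rightarrow> real"
  assumes pd: "\<And>X. has_pd i F (F' X) X"
    and contF: "continuous_on UNIV F" and contF': "continuous_on UNIV F'"
    and K: "K \<subseteq> cbox p q" and zero: "\<And>X. X \<notin> K \<Longrightarrow> F X = 0 \<and> F' X = 0"
  shows "(F' has_integral 0) (cbox p q)"
proof -
  let ?e = "axis i (1::real)"
  \<comment> \<open>The margin of \<open>1\<close> on every side leaves room for all translates with
    \<open>\<bar>t\<bar> < 1\<close>.\<close>
  define P where "P = p - (\<chi> j. 1)"
  define Q where "Q = q + (\<chi> j. 1)"
  have shift: "integral (cbox P Q) (\<lambda>Z. F (Z + t *\<^sub>R ?e)) = integral (cbox p q) F" if t: "\<bar>t\<bar> < 1" for t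
  proof -
    have F: "(F has_integral integral (cbox p q) F) (cbox p q)"
      by (intro integrable_integral integrable_continuous continuous_on_subset[OF contF]) auto
    have int: "((\<lambda>Z. F (Z + t *\<^sub>R ?e)) has_integral integral (cbox p q) F) (cbox (p - t *\<^sub>R ?e) (q - t *\<^sub>R ?e))"
      using has_integral_shift_cbox[OF F] .
    have sub: "cbox (p - t *\<^sub>R ?e) (q - t *\<^sub>R ?e) \<subseteq> cbox P Q"
    proof
      fix x assume x: "x \<in> cbox (p - t *\<^sub>R ?e) (q - t *\<^sub>R ?e)"
      have "\<bar>t * ?e $ j\<bar> \<le> 1" for j
        using t by (auto simp: axis_def)
      moreover have "p $ j - t * ?e $ j \<le> x $ j \<and> x $ j \<le> q $ j - t * ?e $ j" for j
        using x by (simp add: mem_box_cart)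
      ultimately have "P $ j \<le> x $ j \<and> x $ j \<le> Q $ j" for j
        unfolding P_def Q_def by (simp, smt (verit, best))
      then show "x \<in> cbox P Q" by (simp add: mem_box_cart)
    qed
    have F0: "F (Z + t *\<^sub>R ?e) = 0" if "Z \<notin> cbox (p - t *\<^sub>R ?e) (q - t *\<^sub>R ?e)" for Z
    proof -
      have "Z + t *\<^sub>R ?e \<notin> cbox p q"
        using that by (auto simp: mem_box_cart algebra_simps)
      then show ?thesis using K zero by blast
    qed
    have "((\<lambda>Z. F (Z + t *\<^sub>R ?e)) has_integral integral (cbox p q) F) (cbox P Q)"
      by (rule has_integral_on_superset[OF int F0 sub])
    then show ?thesis by (rule integral_unique)
  qed
  have sub: "cbox p q \<subseteq> cbox P Q"
  proof
    fix x assume "x \<in> cbox p q"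
    then have "P $ j \<le> x $ j \<and> x $ j \<le> Q $ j" for j
      unfolding P_def Q_def mem_box_cart by (simp, smt (verit, best))
    then show "x \<in> cbox P Q" by (simp add: mem_box_cart)
  qed
  have d1: "((\<lambda>t. integral (cbox P Q) (\<lambda>Z. F (Z + t *\<^sub>R ?e))) has_field_derivative
          integral (cbox P Q) (\<lambda>Z. F' (Z + 0 *\<^sub>R ?e))) (at 0 within UNIV)"
  proof (rule leibniz_rule_field_derivative)
    show "((\<lambda>t. F (Z + t *\<^sub>R ?e)) has_field_derivative F' (Z + t *\<^sub>R ?e)) (at t within UNIV)" for Z t
      using has_pd_line[OF pd] by simp
    show "(\<lambda>Z. F (Z + t *\<^sub>R ?e)) integrable_on cbox P Q" for t
      by (intro integrable_continuous continuous_on_compose2[OF contF] continuous_intros) auto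
    show "continuous_on (UNIV \<times> cbox P Q) (\<lambda>(t, Z). F' (Z + t *\<^sub>R ?e))"
      unfolding split_beta
      by (intro continuous_on_compose2[OF contF'] continuous_intros) auto
  qed auto
  have d2: "((\<lambda>t. integral (cbox P Q) (\<lambda>Z. F (Z + t *\<^sub>R ?e))) has_field_derivative 0) (at 0)"
  proof -
    have "\<forall>\<^sub>F t in nhds (0::real). t \<in> {-1<..<1}"
      by (rule eventually_nhds_in_open) auto
    then have "\<forall>\<^sub>F t in nhds (0::real). integral (cbox P Q) (\<lambda>Z. F (Z + t *\<^sub>R ?e)) = integral (cbox p q) F"
      by eventually_elim (rule shift, auto)
    from DERIV_cong_ev[OF refl this refl] show ?thesis by simp
  qed
  have PQ: "integral (cbox P Q) F' = 0"
    using DERIV_unique[OF d1 d2] by simp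
  have "F' integrable_on cbox p q"
    by (intro integrable_continuous continuous_on_subset[OF contF']) auto
  then have int: "(F' has_integral integral (cbox p q) F') (cbox p q)"
    by (rule integrable_integral)
  have F0: "F' X = 0" if "X \<notin> cbox p q" for X
    using that K zero by blast
  have "(F' has_integral integral (cbox p q) F') (cbox P Q)"
    by (rule has_integral_on_superset[OF int F0 sub])
  then have "integral (cbox p q) F' = 0"
    using PQ integral_unique by metis
  then show ?thesis
    using int by metis
qed

section \<open>Functions with continuous first and pure second partial derivatives\<close>

text \<open>The derivatives are carried as explicit families, so that the Laplacian of a composite
  is available as the formula \<open>\<Sum>i\<in>UNIV. u2 i Z\<close>; mixed derivatives do not
  occur in it.\<close>

definition has_pd2 ::
  "(real ^ 'n::finite) set \<Rightarrow> (real ^ 'n \<Rightarrow> real) \<Rightarrow> ('n \<Rightarrow> real ^ 'n \<Rightarrow> real) \<Rightarrow> ('n \<Rightarrow> real ^ 'n \<Rightarrow> real) \<Rightarrow> bool"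
  where "has_pd2 S u u1 u2 \<longleftrightarrow> continuous_on S u \<and>
    (\<forall>i. continuous_on S (u1 i) \<and> continuous_on S (u2 i) \<and>
      (\<forall>Z\<in>S. has_pd i u (u1 i Z) Z \<and> has_pd i (u1 i) (u2 i Z) Z))"

lemma has_pd2I:
  assumes "continuous_on S u" "\<And>i. continuous_on S (u1 i)" "\<And>i. continuous_on S (u2 i)"
    "\<And>i Z. Z \<in> S \<Longrightarrow> has_pd i u (u1 i Z) Z" "\<And>i Z. Z \<in> S \<Longrightarrow> has_pd i (u1 i) (u2 i Z) Z"
  shows "has_pd2 S u u1 u2"
  using assms unfolding has_pd2_def by blast

lemma has_pd2D:
  assumes "has_pd2 S u u1 u2"
  shows "continuous_on S u" "continuous_on S (u1 i)" "continuous_on S (u2 i)"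
    "Z \<in> S \<Longrightarrow> has_pd i u (u1 i Z) Z" "Z \<in> S \<Longrightarrow> has_pd i (u1 i) (u2 i Z) Z"
  using assms unfolding has_pd2_def by auto

lemma C2_on_imp_has_pd2:
  assumes "C2_on S u"
  shows "has_pd2 S u (\<lambda>i. partial_deriv i u) (\<lambda>i. partial_deriv i (partial_deriv i u))"
proof (rule has_pd2I)
  show "continuous_on S u"
    using assms differentiable_imp_continuous_within
    unfolding C2_on_def C1_on_def by (blast intro: continuous_at_imp_continuous_on)
qed (use assms in \<open>auto simp: C2_on_def C1_on_def intro: has_pd_partial_deriv\<close>)

lemma has_pd2_subset: "has_pd2 S u u1 u2 \<Longrightarrow> T \<subseteq> S \<Longrightarrow> has_pd2 T u u1 u2"
  unfolding has_pd2_def by (meson continuous_on_subset subsetD)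

lemma has_pd2_diff:
  assumes "has_pd2 S u u1 u2" "has_pd2 S v v1 v2"
  shows "has_pd2 S (\<lambda>Z. u Z - v Z) (\<lambda>i Z. u1 i Z - v1 i Z) (\<lambda>i Z. u2 i Z - v2 i Z)"
  using assms unfolding has_pd2_def by (auto intro!: continuous_intros has_pd_diff)

lemma has_pd2_shift:
  assumes "has_pd2 S u u1 u2" "\<And>Z. Z \<in> T \<Longrightarrow> Z + h \<in> S"
  shows "has_pd2 T (\<lambda>Z. u (Z + h)) (\<lambda>i Z. u1 i (Z + h)) (\<lambda>i Z. u2 i (Z + h))"
proof -
  have "continuous_on T (\<lambda>Z. w (Z + h))" if "continuous_on S w" for w :: "real ^ 'a \<Rightarrow> real"
    by (rule continuous_on_compose2[OF that]) (use assms(2) in \<open>auto intro!: continuous_intros\<close>)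
  with assms show ?thesis
    unfolding has_pd2_def by (auto intro!: has_pd_shift)
qed

lemma has_pd2_linear:
  "has_pd2 S (\<lambda>Z. c * Z $ k) (\<lambda>i Z. if k = i then c else 0) (\<lambda>i Z. 0)"
proof (rule has_pd2I)
  show "has_pd i (\<lambda>Z. c * Z $ k) (if k = i then c else 0) Z" for i and Z :: "real ^ 'a"
    using has_pd_mult[OF has_pd_const[of i c Z] has_pd_nth[of i k Z]] by (cases "k = i") auto
qed (auto intro!: continuous_intros has_pd_const)

text \<open>Summed over \<open>i\<close>, the second derivatives read \<open>e2 (u Z)\<close> times
  the squared gradient plus \<open>e1 (u Z)\<close> times the Laplacian of \<open>u\<close>. For
  convex \<open>e\<close> the gradient term is nonnegative, which is how truncations by
  \<open>soft\<close> are handled.\<close>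

lemma has_pd2_chain:
  assumes u: "has_pd2 S u u1 u2"
    and e: "\<And>t. (e has_real_derivative e1 t) (at t)" "\<And>t. (e1 has_real_derivative e2 t) (at t)"
      "continuous_on UNIV e2"
  shows "has_pd2 S (\<lambda>Z. e (u Z)) (\<lambda>i Z. e1 (u Z) * u1 i Z)
    (\<lambda>i Z. e2 (u Z) * (u1 i Z)\<^sup>2 + e1 (u Z) * u2 i Z)"
proof (rule has_pd2I)
  have ce: "continuous_on UNIV e" "continuous_on UNIV e1"
    using e DERIV_continuous_on has_field_derivative_at_within by metis+
  note c = has_pd2D(1-3)[OF u] and c2 = continuous_on_compose2[OF _ has_pd2D(1)[OF u], of UNIV]
  show "continuous_on S (\<lambda>Z. e (u Z))" by (rule c2[OF ce(1)]) simp
  show "continuous_on S (\<lambda>Z. e1 (u Z) * u1 i Z)" for i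
    by (intro continuous_intros c c2[OF ce(2)]) simp
  show "continuous_on S (\<lambda>Z. e2 (u Z) * (u1 i Z)\<^sup>2 + e1 (u Z) * u2 i Z)" for i
    by (intro continuous_intros c c2[OF ce(2)] c2[OF e(3)]) simp_all
  show "has_pd i (\<lambda>Z. e (u Z)) (e1 (u Z) * u1 i Z) Z" if "Z \<in> S" for i Z
    by (rule has_pd_chain[OF has_pd2D(4)[OF u that] e(1)])
  show "has_pd i (\<lambda>Z. e1 (u Z) * u1 i Z) (e2 (u Z) * (u1 i Z)\<^sup>2 + e1 (u Z) * u2 i Z) Z"
    if "Z \<in> S" for i Z
    using has_pd_mult[OF has_pd_chain[OF has_pd2D(4)[OF u that] e(2)] has_pd2D(5)[OF u that]]
    by (simp add: power2_eq_square algebra_simps)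
qed

lemma has_pd2_eq_0:
  assumes "has_pd2 S u u1 u2" "open T" "T \<subseteq> S" "Z \<in> T" "\<And>X. X \<in> T \<Longrightarrow> u X = 0"
  shows "u1 i Z = 0" "u2 i Z = 0"
proof -
  have u1: "u1 i X = 0" if "X \<in> T" for X
    using has_pd_unique has_pd_transform[OF has_pd_const assms(2) that, of 0 u] assms(3,5) that
      has_pd2D(4)[OF assms(1)] by (metis subsetD)
  then show "u1 i Z = 0" using assms(4) by blast
  show "u2 i Z = 0"
    using has_pd_unique has_pd_transform[OF has_pd_const assms(2,4), of 0 "u1 i"] u1 assms(3,4)
      has_pd2D(5)[OF assms(1)] by (metis subsetD)
qed

section \<open>Extension by zero and Green's identity\<close>

text \<open>\<open>H\<close> and the complement of \<open>K\<close> form an open cover; the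
  extension is \<open>F\<close> on the first set and \<open>0\<close> on the second.\<close>

lemma continuous_on_extend_0:
  fixes F :: "'a::t2_space \<Rightarrow> real"
  assumes "open H" "compact K" "K \<subseteq> H" "continuous_on H F" "\<And>Z. Z \<in> H - K \<Longrightarrow> F Z = 0"
  shows "continuous_on UNIV (\<lambda>Z. if Z \<in> H then F Z else 0)"
proof -
  have "continuous_on H (\<lambda>Z. if Z \<in> H then F Z else 0)"
    using assms(4) by (rule continuous_on_eq) simp
  moreover have "continuous_on (- K) (\<lambda>Z. if Z \<in> H then F Z else 0)"
    by (rule continuous_on_eq[of _ "\<lambda>Z. 0"]) (use assms(5) in auto)
  ultimately have "continuous_on (H \<union> - K) (\<lambda>Z. if Z \<in> H then F Z else 0)"
    using assms(1,2) by (intro continuous_on_open_Un) (auto simp: compact_imp_closed)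
  moreover have "H \<union> - K = UNIV" using assms(3) by blast
  ultimately show ?thesis by simp
qed

text \<open>The integrand is the sum over \<open>i\<close> of the partial derivatives of
  \<open>a * b1 i - b * a1 i\<close>, each of which integrates to \<open>0\<close>. The hypothesis
  concerns the product \<open>a * b\<close> only, so different factors may vanish at different
  places: one may be zero near the boundary of \<open>H\<close>, the other outside a ball.\<close>

lemma Green_identity:
  fixes a b :: "real ^ 'n::finite \<Rightarrow> real"
  assumes a: "has_pd2 H a a1 a2" and b: "has_pd2 H b b1 b2"
    and H: "open H" and K: "compact K" "K \<subseteq> H" "K \<subseteq> cbox p q"
    and ab: "\<And>Z. Z \<in> H - K \<Longrightarrow> a Z * b Z = 0"
  shows "((\<lambda>Z. if Z \<in> H then a Z * (\<Sum>i\<in>UNIV. b2 i Z) - b Z * (\<Sum>i\<in>UNIV. a2 i Z) else 0)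
    has_integral 0) (cbox p q)"
proof -
  define F where "F = (\<lambda>i Z. if Z \<in> H then a Z * b1 i Z - b Z * a1 i Z else 0)"
  define F' where "F' = (\<lambda>i Z. if Z \<in> H then a Z * b2 i Z - b Z * a2 i Z else 0)"
  have open_HK: "open (H - K)" using H K(1) by (simp add: open_Diff compact_imp_closed)
  \<comment> \<open>Where one factor is nonzero it is so on a neighbourhood, hence the other factor
    vanishes there together with its derivatives. Where both factors are zero, every term of
    \<open>F\<close> and \<open>F'\<close> contains a zero factor.\<close>
  have van: "v Z = 0 \<and> v1 i Z = 0 \<and> v2 i Z = 0"
    if Z: "Z \<in> H - K" and nz: "u Z \<noteq> 0" and v: "has_pd2 H v v1 v2" and u: "continuous_on H u"
      and uv: "\<And>Z. Z \<in> H - K \<Longrightarrow> u Z * v Z = 0"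
    for i Z v v1 v2 and u :: "real ^ 'n \<Rightarrow> real"
  proof -
    obtain T where T: "open T" "T \<inter> (H - K) = u -` (- {0}) \<inter> (H - K)"
      using continuous_on_open_invariant[THEN iffD1, rule_format, of "H - K" u "- {0}"]
        continuous_on_subset[OF u] by auto
    have "open (T \<inter> (H - K))" "T \<inter> (H - K) \<subseteq> H" "Z \<in> T \<inter> (H - K)"
      using open_Int[OF T(1) open_HK] T(2) Z nz by auto
    moreover have "v X = 0" if "X \<in> T \<inter> (H - K)" for X
      using that T uv by auto
    ultimately show ?thesis
      using has_pd2_eq_0[OF v] by meson
  qed
  have zero: "F i Z = 0 \<and> F' i Z = 0" if "Z \<notin> K" for i Z
  proof (cases "Z \<in> H")
    case True
    then have Z: "Z \<in> H - K" using that by simp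
    have ba: "b Z * a Z = 0" if "Z \<in> H - K" for Z using ab[OF that] by auto
    show ?thesis
      using van[OF Z _ b has_pd2D(1)[OF a] ab, of i] van[OF Z _ a has_pd2D(1)[OF b] ba, of i]
      unfolding F_def F'_def by fastforce
  qed (simp add: F_def F'_def)
  have cF: "continuous_on UNIV (F i)" for i
    unfolding F_def
  proof (rule continuous_on_extend_0[OF H K(1,2)])
    show "continuous_on H (\<lambda>Z. a Z * b1 i Z - b Z * a1 i Z)"
      by (intro continuous_intros has_pd2D[OF a] has_pd2D[OF b])
  qed (use zero[of _ i] in \<open>force simp: F_def\<close>)
  have cF': "continuous_on UNIV (F' i)" for i
    unfolding F'_def
  proof (rule continuous_on_extend_0[OF H K(1,2)])
    show "continuous_on H (\<lambda>Z. a Z * b2 i Z - b Z * a2 i Z)"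
      by (intro continuous_intros has_pd2D[OF a] has_pd2D[OF b])
  qed (use zero[of _ i] in \<open>force simp: F'_def\<close>)
  have pd: "has_pd i (F i) (F' i Z) Z" for i Z
  proof (cases "Z \<in> H")
    case True
    have "has_pd i (\<lambda>Z. a Z * b1 i Z - b Z * a1 i Z) (F' i Z) Z"
      using has_pd_diff[OF has_pd_mult[OF has_pd2D(4)[OF a True] has_pd2D(5)[OF b True]]
          has_pd_mult[OF has_pd2D(4)[OF b True] has_pd2D(5)[OF a True]], of i] True
      by (simp add: F'_def algebra_simps)
    then show ?thesis
      by (rule has_pd_transform[OF _ H True]) (simp add: F_def)
  next
    case False
    then have "Z \<in> - K" using K by blast
    then show ?thesis
      using has_pd_transform[OF has_pd_const, of "- K" Z 0 "F i" i] zero K(1) compact_imp_closed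
      by (metis ComplD open_Compl)
  qed
  have "((\<lambda>Z. \<Sum>i\<in>UNIV. F' i Z) has_integral (\<Sum>i\<in>(UNIV :: 'n set). 0)) (cbox p q)"
    by (intro has_integral_sum integral_pd_eq_0[OF pd cF cF' K(3) zero]) auto
  moreover have "(\<Sum>i\<in>UNIV. F' i Z) =
    (if Z \<in> H then a Z * (\<Sum>i\<in>UNIV. b2 i Z) - b Z * (\<Sum>i\<in>UNIV. a2 i Z) else 0)" for Z
    by (simp add: F'_def sum_subtractf sum_distrib_left)
  ultimately show ?thesis by simp
qed

subsection \<open>Truncated powers and kernels\<close>

lemma DERIV_pos_pow:
  "((\<lambda>t::real. max 0 t ^ Suc (Suc m)) has_real_derivative real (Suc (Suc m)) * max 0 t ^ Suc m) (at t)"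
proof -
  consider "t > 0" | "t < 0" | "t = 0" by linarith
  then show ?thesis
  proof cases
    case 1
    have "\<forall>\<^sub>F s in nhds t. s \<in> {0<..}" by (rule eventually_nhds_in_open) (use 1 in auto)
    then have "\<forall>\<^sub>F s in nhds t. max 0 s ^ Suc (Suc m) = s ^ Suc (Suc m)"
      by eventually_elim (simp add: max_def)
    from DERIV_cong_ev[OF refl this refl] show ?thesis
      using DERIV_pow[of "Suc (Suc m)" t] 1 by (simp add: max_def)
  next
    case 2
    have "\<forall>\<^sub>F s in nhds t. s \<in> {..<0}" by (rule eventually_nhds_in_open) (use 2 in auto)
    then have "\<forall>\<^sub>F s in nhds t. max 0 s ^ Suc (Suc m) = 0"
      by eventually_elim (simp add: max_def)
    from DERIV_cong_ev[OF refl this refl] show ?thesis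
      using 2 by (simp add: max_def)
  next
    case 3
    have "((\<lambda>h::real. max 0 h ^ Suc (Suc m) / h) \<longlongrightarrow> 0) (at 0)"
    proof (rule Lim_null_comparison)
      show "\<forall>\<^sub>F h in at (0::real). norm (max 0 h ^ Suc (Suc m) / h) \<le> \<bar>h\<bar> ^ Suc m"
      proof (rule always_eventually, rule allI)
        fix h :: real
        show "norm (max 0 h ^ Suc (Suc m) / h) \<le> \<bar>h\<bar> ^ Suc m"
          by (cases "h \<ge> 0") (simp_all add: max_def mult_nonpos_nonneg)
      qed
      have "((\<lambda>h::real. \<bar>h\<bar> ^ Suc m) \<longlongrightarrow> \<bar>0\<bar> ^ Suc m) (at 0)"
        by (intro tendsto_intros)
      then show "((\<lambda>h::real. \<bar>h\<bar> ^ Suc m) \<longlongrightarrow> 0) (at 0)" by simp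
    qed
    then show ?thesis using 3 unfolding DERIV_def by simp
  qed
qed

text \<open>A convex \<open>C\<^sup>2\<close> approximation of \<open>max 0 t\<close> from below that vanishes for \<open>t \<le> d\<close>,
  with its first two derivatives. The junk values at \<open>t = 0\<close> are \<open>0\<close>, as they should be.\<close>

definition soft :: "real \<Rightarrow> real \<Rightarrow> real" where
  "soft d t = max 0 (t - d) ^ 3 / t\<^sup>2"

definition soft1 :: "real \<Rightarrow> real \<Rightarrow> real" where
  "soft1 d t = max 0 (t - d) ^ 2 * (t + 2 * d) / t ^ 3"

definition soft2 :: "real \<Rightarrow> real \<Rightarrow> real" where
  "soft2 d t = 6 * d\<^sup>2 * max 0 (t - d) / t ^ 4"

lemma soft_eq_0: "t \<le> d \<Longrightarrow> soft d t = 0" "t \<le> d \<Longrightarrow> soft1 d t = 0" "t \<le> d \<Longrightarrow> soft2 d t = 0"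
  by (simp_all add: soft_def soft1_def soft2_def max_def)

lemma DERIV_soft:
  assumes "d > 0"
  shows "(soft d has_real_derivative soft1 d t) (at t)"
    and "(soft1 d has_real_derivative soft2 d t) (at t)"
proof -
  have td: "((\<lambda>t. t - d) has_real_derivative 1) (at t)"
    by (auto intro!: derivative_eq_intros)
  have p3: "((\<lambda>t. max 0 (t - d) ^ 3) has_real_derivative 3 * max 0 (t - d) ^ 2) (at t)"
    using DERIV_chain2[of "\<lambda>t. max 0 t ^ Suc (Suc 1)" _ "\<lambda>t. t - d" t 1 UNIV, OF DERIV_pos_pow[of 1 "t - d"] td]
    by (simp add: numeral_eq_Suc)
  have p2: "((\<lambda>t. max 0 (t - d) ^ 2) has_real_derivative 2 * max 0 (t - d)) (at t)"
    using DERIV_chain2[of "\<lambda>t. max 0 t ^ Suc (Suc 0)" _ "\<lambda>t. t - d" t 1 UNIV, OF DERIV_pos_pow[of 0 "t - d"] td]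
    by (simp add: numeral_eq_Suc)
  \<comment> \<open>Since \<open>d > 0\<close>, the quotient by a power of \<open>t\<close> is
    differentiated only at points \<open>t > 0\<close>; at \<open>t = d\<close> the rule for the
    truncated power covers both sides at once.\<close>
  consider "t < d" | "t > 0" "t \<ge> d" using assms by linarith
  then have "(soft d has_real_derivative soft1 d t) (at t) \<and> (soft1 d has_real_derivative soft2 d t) (at t)"
  proof cases
    case 1
    have ev: "\<forall>\<^sub>F s in nhds t. s \<in> {..<d}" by (rule eventually_nhds_in_open) (use 1 in auto)
    then have "\<forall>\<^sub>F s in nhds t. soft d s = 0"
      by eventually_elim (simp add: soft_eq_0)
    from DERIV_cong_ev[OF refl this refl] have s: "(soft d has_real_derivative soft1 d t) (at t)"
      using 1 by (simp add: soft_eq_0)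
    from ev have "\<forall>\<^sub>F s in nhds t. soft1 d s = 0"
      by eventually_elim (simp add: soft_eq_0)
    from DERIV_cong_ev[OF refl this refl] have "(soft1 d has_real_derivative soft2 d t) (at t)"
      using 1 by (simp add: soft_eq_0)
    with s show ?thesis ..
  next
    case 2
    define p where "p = max 0 (t - d)"
    have p: "p = t - d" using 2 by (simp add: p_def)
    have "((\<lambda>t. max 0 (t - d) ^ 3 / t\<^sup>2) has_real_derivative
        (3 * p ^ 2 * t\<^sup>2 - p ^ 3 * (2 * t)) / (t\<^sup>2 * t\<^sup>2)) (at t)"
      unfolding p_def by (rule DERIV_divide[OF p3]) (use 2 in \<open>auto intro!: derivative_eq_intros\<close>)
    moreover have "(3 * p ^ 2 * t\<^sup>2 - p ^ 3 * (2 * t)) / (t\<^sup>2 * t\<^sup>2) = soft1 d t"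
      unfolding soft1_def p_def[symmetric] using 2
      by (simp add: p field_simps power2_eq_square power3_eq_cube)
    ultimately have s: "(soft d has_real_derivative soft1 d t) (at t)"
      unfolding soft_def by simp
    have "((\<lambda>t. max 0 (t - d) ^ 2 * (t + 2 * d)) has_real_derivative
        (2 * p * (t + 2 * d) + 1 * p ^ 2)) (at t)"
      unfolding p_def by (rule DERIV_mult[OF p2]) (auto intro!: derivative_eq_intros)
    then have "((\<lambda>t. max 0 (t - d) ^ 2 * (t + 2 * d) / t ^ 3) has_real_derivative
        ((2 * p * (t + 2 * d) + 1 * p ^ 2) * t ^ 3 - p ^ 2 * (t + 2 * d) * (3 * t ^ 2)) / (t ^ 3 * t ^ 3)) (at t)"
      unfolding p_def by (rule DERIV_divide) (use 2 in \<open>auto intro!: derivative_eq_intros\<close>)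
    moreover have "((2 * p * (t + 2 * d) + 1 * p ^ 2) * t ^ 3 - p ^ 2 * (t + 2 * d) * (3 * t ^ 2)) / (t ^ 3 * t ^ 3)
        = soft2 d t"
    proof -
      have "((2 * p * (t + 2 * d) + 1 * p ^ 2) * t ^ 3 - p ^ 2 * (t + 2 * d) * (3 * t ^ 2)) * t ^ 4
        = (6 * d\<^sup>2 * p) * (t ^ 3 * t ^ 3)" unfolding p by algebra
      then show ?thesis
        unfolding soft2_def p_def[symmetric] using 2 by (subst frac_eq_eq) auto
    qed
    ultimately have "(soft1 d has_real_derivative soft2 d t) (at t)"
      unfolding soft1_def by simp
    with s show ?thesis ..
  qed
  then show "(soft d has_real_derivative soft1 d t) (at t)" "(soft1 d has_real_derivative soft2 d t) (at t)" by auto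
qed

lemma continuous_on_soft:
  assumes "d > 0"
  shows "continuous_on UNIV (soft d)" "continuous_on UNIV (soft1 d)" "continuous_on UNIV (soft2 d)"
proof -
  show "continuous_on UNIV (soft d)" "continuous_on UNIV (soft1 d)"
    by (intro continuous_at_imp_continuous_on ballI DERIV_isCont[OF DERIV_soft(1)[OF assms]]
        DERIV_isCont[OF DERIV_soft(2)[OF assms]])+
  have "continuous_on {0<..} (soft2 d)"
    unfolding soft2_def by (intro continuous_intros) auto
  moreover have "continuous_on {..<d} (soft2 d)"
    by (rule continuous_on_eq[of _ "\<lambda>t. 0"]) (auto simp: soft_eq_0)
  ultimately have "continuous_on ({0<..} \<union> {..<d}) (soft2 d)"
    by (intro continuous_on_open_Un) auto
  moreover have "{0<..} \<union> {..<d} = UNIV" using assms by auto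
  ultimately show "continuous_on UNIV (soft2 d)" by simp
qed

lemma soft_bounds:
  assumes "d > 0"
  shows "0 \<le> soft d t" "soft d t \<le> max 0 t" "0 \<le> soft1 d t" "soft1 d t \<le> 1" "0 \<le> soft2 d t"
proof -
  have "0 \<le> soft d t \<and> soft d t \<le> max 0 t \<and> 0 \<le> soft1 d t \<and> soft1 d t \<le> 1 \<and> 0 \<le> soft2 d t"
  proof (cases "t \<le> d")
    case False
    then have t: "t > d" "t > 0" using assms by auto
    have "(t - d) ^ 3 \<le> t ^ 3" using t assms by (intro power_mono) auto
    then have "soft d t \<le> t"
      using t by (simp add: soft_def divide_le_eq power2_eq_square power3_eq_cube)
    moreover have "(t - d)\<^sup>2 * (t + 2 * d) \<le> t ^ 3"
    proof -
      have "t ^ 3 - (t - d)\<^sup>2 * (t + 2 * d) = d\<^sup>2 * (3 * t - 2 * d)" by algebra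
      also have "\<dots> \<ge> 0" using t by simp
      finally show ?thesis by simp
    qed
    then have "soft1 d t \<le> 1" using t by (simp add: soft1_def divide_le_eq)
    ultimately show ?thesis using t assms by (simp add: soft_def soft1_def soft2_def)
  qed (simp add: soft_eq_0)
  then show "0 \<le> soft d t" "soft d t \<le> max 0 t" "0 \<le> soft1 d t" "soft1 d t \<le> 1" "0 \<le> soft2 d t"
    by auto
qed

lemma soft1_tendsto:
  assumes "t > 0"
  shows "(\<lambda>j. soft1 (inverse (real (Suc j))) t) \<longlonglongrightarrow> 1"
proof -
  have "(\<lambda>j. soft1 (inverse (real (Suc j))) t) \<longlonglongrightarrow> max 0 (t - 0) ^ 2 * (t + 2 * 0) / t ^ 3"
    unfolding soft1_def by (intro tendsto_intros LIMSEQ_inverse_real_of_nat) (use assms in auto)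
  then show ?thesis using assms by (simp add: power2_eq_square power3_eq_cube)
qed

section \<open>Radial bumps and their Laplacians\<close>

text \<open>For \<open>m > 0\<close> and \<open>r \<ge> 0\<close> it vanishes off the ball of radius
  \<open>r\<close> about \<open>Y\<close>. The case \<open>m = 3\<close> is twice continuously
  differentiable and serves as test function; the cases \<open>1\<close> and \<open>2\<close> arise
  from its Laplacian.\<close>

definition bump :: "nat \<Rightarrow> real ^ 'n::finite \<Rightarrow> real \<Rightarrow> real ^ 'n \<Rightarrow> real" where
  "bump m Y r Z = max 0 (r\<^sup>2 - (norm (Z - Y))\<^sup>2) ^ m"

lemma has_pd2_sq_dist:
  "has_pd2 UNIV (\<lambda>Z. r\<^sup>2 - (norm (Z - Y))\<^sup>2) (\<lambda>i Z. - 2 * (Z $ i - Y $ i)) (\<lambda>i Z. - 2)"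
proof (rule has_pd2I)
  show "has_pd i (\<lambda>Z. r\<^sup>2 - (norm (Z - Y))\<^sup>2) (- 2 * (Z $ i - Y $ i)) Z" for i and Z :: "real ^ 'a"
  proof -
    have "(norm ((Z - Y) + t *\<^sub>R axis i 1))\<^sup>2 = (norm (Z - Y))\<^sup>2 + 2 * t * (Z $ i - Y $ i) + t\<^sup>2" for t
      unfolding power2_norm_eq_inner inner_add_left inner_add_right
      by (simp add: inner_axis inner_axis' algebra_simps power2_eq_square)
    then have "(norm (Z + t *\<^sub>R axis i 1 - Y))\<^sup>2 = (norm (Z - Y))\<^sup>2 + 2 * t * (Z $ i - Y $ i) + t\<^sup>2" for t
      by (simp add: algebra_simps)
    then show ?thesis unfolding has_pd_def by (auto intro!: derivative_eq_intros)
  qed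
  show "has_pd i (\<lambda>Z. - 2 * (Z $ i - Y $ i)) (- 2) Z" for i and Z :: "real ^ 'a"
    unfolding has_pd_def by (auto simp: axis_def intro!: derivative_eq_intros)
qed (intro continuous_intros)+

text \<open>For \<open>s = r\<^sup>2 - (norm (Z - Y))\<^sup>2\<close> the squared gradient is
  \<open>4 * (r\<^sup>2 - s)\<close> and the Laplacian is \<open>- 2 * CARD('n)\<close>. Inserting
  these into the chain rule for the cube of the positive part eliminates the distance.\<close>

lemma has_pd2_bump3:
  fixes Y :: "real ^ 'n::finite"
  obtains b1 b2 where "has_pd2 UNIV (bump 3 Y r) b1 b2"
    "\<And>Z. (\<Sum>i\<in>UNIV. b2 i Z) = 24 * r\<^sup>2 * bump 1 Y r Z - (6 * real CARD('n) + 24) * bump 2 Y r Z"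
proof -
  let ?s = "\<lambda>Z. r\<^sup>2 - (norm (Z - Y))\<^sup>2"
  define b1 where "b1 = (\<lambda>i Z. (3 * max 0 (?s Z) ^ 2) * (- 2 * (Z $ i - Y $ i)))"
  define b2 where "b2 = (\<lambda>i Z. (6 * max 0 (?s Z)) * (- 2 * (Z $ i - Y $ i))\<^sup>2
    + (3 * max 0 (?s Z) ^ 2) * - 2)"
  have "has_pd2 UNIV (\<lambda>Z. max 0 (?s Z) ^ 3) b1 b2"
    unfolding b1_def b2_def
  proof (rule has_pd2_chain[OF has_pd2_sq_dist])
    show "((\<lambda>t::real. max 0 t ^ 3) has_real_derivative 3 * max 0 t ^ 2) (at t)" for t
      using DERIV_pos_pow[of 1 t] by (simp add: numeral_eq_Suc)
    show "((\<lambda>t::real. 3 * max 0 t ^ 2) has_real_derivative 6 * max 0 t) (at t)" for t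
      using DERIV_cmult[OF DERIV_pos_pow[of 0 t], of 3] by (simp add: numeral_eq_Suc)
    show "continuous_on UNIV (\<lambda>t::real. 6 * max 0 t)" by (intro continuous_intros)
  qed
  moreover have "(\<Sum>i\<in>UNIV. b2 i Z) = 24 * r\<^sup>2 * bump 1 Y r Z - (6 * real CARD('n) + 24) * bump 2 Y r Z" for Z
  proof -
    let ?p = "max 0 (?s Z)"
    have n: "(norm (Z - Y))\<^sup>2 = (\<Sum>i\<in>UNIV. (Z $ i - Y $ i)\<^sup>2)"
      unfolding power2_norm_eq_inner inner_vec_def by (simp add: power2_eq_square)
    have "?p * ?s Z = ?p\<^sup>2"
      by (simp add: max_def power2_eq_square)
    then have pn: "?p * (norm (Z - Y))\<^sup>2 = r\<^sup>2 * ?p - ?p\<^sup>2" by (simp add: algebra_simps)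
    have "b2 i Z = 24 * ?p * (Z $ i - Y $ i)\<^sup>2 - 6 * ?p\<^sup>2" for i
      unfolding b2_def by algebra
    then have "(\<Sum>i\<in>UNIV. b2 i Z) = 24 * (?p * (norm (Z - Y))\<^sup>2) - 6 * real CARD('n) * ?p\<^sup>2"
      unfolding n by (simp add: sum_subtractf sum_distrib_left mult.assoc)
    then show ?thesis unfolding pn bump_def by (simp add: algebra_simps)
  qed
  ultimately show ?thesis using that by (simp add: bump_def[abs_def])
qed

section \<open>Reflection and the odd kernels\<close>

definition reflect :: "'n \<Rightarrow> real ^ 'n::finite \<Rightarrow> real ^ 'n" where
  "reflect k Y = Y - (2 * Y $ k) *\<^sub>R axis k 1"

lemma norm_diff_reflect: "(norm (Z - reflect k Y))\<^sup>2 = (norm (Z - Y))\<^sup>2 + 4 * Z $ k * Y $ k"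
proof -
  have "(norm ((Z - Y) + (2 * Y $ k) *\<^sub>R axis k 1))\<^sup>2 = (norm (Z - Y))\<^sup>2 + 4 * Z $ k * Y $ k"
    unfolding power2_norm_eq_inner inner_add_left inner_add_right
    by (simp add: inner_axis inner_axis' algebra_simps power2_eq_square)
  then show ?thesis by (simp add: reflect_def algebra_simps)
qed

text \<open>Odd in the variable \<open>Z $ k\<close>, hence zero on the boundary of the half-space.\<close>

definition kern :: "nat \<Rightarrow> 'n \<Rightarrow> real ^ 'n::finite \<Rightarrow> real \<Rightarrow> real ^ 'n \<Rightarrow> real" where
  "kern m k Y r Z = bump m Y r Z - bump m (reflect k Y) r Z"

text \<open>By \<open>norm_diff_reflect\<close>, a point of the closed half-space is at least as
  close to \<open>Y\<close> as to its mirror image, so the first bump dominates. The other sign and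
  vanishing lemmas for \<open>kern\<close> rest on the same comparison of distances.\<close>

lemma kern_nonneg:
  assumes "0 \<le> Y $ k" "0 \<le> Z $ k"
  shows "0 \<le> kern m k Y r Z"
proof -
  have "0 \<le> 4 * Z $ k * Y $ k" using assms by simp
  then have "max 0 (r\<^sup>2 - ((norm (Z - Y))\<^sup>2 + 4 * Z $ k * Y $ k)) \<le> max 0 (r\<^sup>2 - (norm (Z - Y))\<^sup>2)"
    by linarith
  then show ?thesis
    unfolding kern_def bump_def norm_diff_reflect by (simp only: diff_ge_0_iff_ge) (rule power_mono, auto)
qed

lemma kern_nonpos:
  assumes "0 \<le> Y $ k" "Z $ k \<le> 0"
  shows "kern m k Y r Z \<le> 0"
proof -
  have "4 * Z $ k * Y $ k \<le> 0" using assms by (simp add: mult_nonpos_nonneg)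
  then have "max 0 (r\<^sup>2 - (norm (Z - Y))\<^sup>2) \<le> max 0 (r\<^sup>2 - ((norm (Z - Y))\<^sup>2 + 4 * Z $ k * Y $ k))"
    by linarith
  then show ?thesis
    unfolding kern_def bump_def norm_diff_reflect by (simp only: diff_le_0_iff_le) (rule power_mono, auto)
qed

lemma kern_eq_0:
  assumes "0 \<le> Y $ k" "0 \<le> Z $ k" "0 \<le> r" "r \<le> norm (Z - Y)" "m > 0"
  shows "kern m k Y r Z = 0"
proof -
  have "0 \<le> 4 * Z $ k * Y $ k" using assms by simp
  moreover have "r\<^sup>2 \<le> (norm (Z - Y))\<^sup>2" using assms by (simp add: power_mono)
  ultimately have "max 0 (r\<^sup>2 - (norm (Z - Y))\<^sup>2) = 0" "max 0 (r\<^sup>2 - ((norm (Z - Y))\<^sup>2 + 4 * Z $ k * Y $ k)) = 0"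
    by linarith+
  then show ?thesis
    unfolding kern_def bump_def norm_diff_reflect by simp
qed

lemma kern_pos:
  assumes "0 < Y $ k" "0 < Z $ k" "norm (Z - Y) < r" "m > 0"
  shows "0 < kern m k Y r Z"
proof -
  have "0 < 4 * Z $ k * Y $ k" using assms by simp
  moreover have "(norm (Z - Y))\<^sup>2 < r\<^sup>2" using assms by (simp add: power_strict_mono)
  ultimately have "max 0 (r\<^sup>2 - ((norm (Z - Y))\<^sup>2 + 4 * Z $ k * Y $ k)) < max 0 (r\<^sup>2 - (norm (Z - Y))\<^sup>2)"
    by linarith
  then show ?thesis
    unfolding kern_def bump_def norm_diff_reflect using assms(4)
    by (simp only: diff_gt_0_iff_gt) (rule power_strict_mono, auto)
qed

lemma continuous_on_kern_joint:
  "continuous_on UNIV (\<lambda>x :: real \<times> (real ^ 'n::finite). kern m k Y (fst x) (snd x))"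
  unfolding kern_def bump_def by (intro continuous_intros)

lemma continuous_on_kern: "continuous_on S (kern m k Y r)"
  unfolding kern_def[abs_def] bump_def by (intro continuous_intros)

definition kern_lap :: "'n \<Rightarrow> real ^ 'n::finite \<Rightarrow> real \<Rightarrow> real ^ 'n \<Rightarrow> real" where
  "kern_lap k Y r Z = 24 * r\<^sup>2 * kern 1 k Y r Z - (6 * real CARD('n) + 24) * kern 2 k Y r Z"

lemma has_pd2_kern3:
  obtains b1 b2 where "has_pd2 UNIV (kern 3 k Y r) b1 b2"
    "\<And>Z. (\<Sum>i\<in>UNIV. b2 i Z) = kern_lap k Y r Z"
proof -
  obtain a1 a2 where a: "has_pd2 UNIV (bump 3 Y r) a1 a2"
    "\<And>Z. (\<Sum>i\<in>UNIV. a2 i Z) = 24 * r\<^sup>2 * bump 1 Y r Z - (6 * real CARD('a) + 24) * bump 2 Y r Z"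
    using has_pd2_bump3[of Y r] by blast
  obtain b1 b2 where b: "has_pd2 UNIV (bump 3 (reflect k Y) r) b1 b2"
    "\<And>Z. (\<Sum>i\<in>UNIV. b2 i Z) = 24 * r\<^sup>2 * bump 1 (reflect k Y) r Z - (6 * real CARD('a) + 24) * bump 2 (reflect k Y) r Z"
    using has_pd2_bump3[of "reflect k Y" r] by blast
  have "kern 3 k Y r = (\<lambda>Z. bump 3 Y r Z - bump 3 (reflect k Y) r Z)"
    by (auto simp: kern_def)
  then have "has_pd2 UNIV (kern 3 k Y r) (\<lambda>i Z. a1 i Z - b1 i Z) (\<lambda>i Z. a2 i Z - b2 i Z)"
    using has_pd2_diff[OF a(1) b(1)] by simp
  then show ?thesis
    by (rule that) (simp add: sum_subtractf a(2) b(2) kern_lap_def kern_def algebra_simps)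
qed

lemma DERIV_kern2:
  "((\<lambda>r. kern 2 k Y r Z) has_real_derivative 4 * r * kern 1 k Y r Z) (at r)"
proof -
  have *: "((\<lambda>r. bump 2 Y r Z) has_real_derivative 4 * r * bump 1 Y r Z) (at r)" for Y
  proof -
    let ?s = "\<lambda>r. r\<^sup>2 - (norm (Z - Y))\<^sup>2"
    have "(?s has_real_derivative 2 * r) (at r)"
      by (auto intro!: derivative_eq_intros)
    from DERIV_chain2[of "\<lambda>t. max 0 t ^ Suc (Suc 0)" _ ?s r, OF DERIV_pos_pow[of 0 "?s r"] this]
    show ?thesis unfolding bump_def by (simp add: numeral_eq_Suc mult_ac)
  qed
  show ?thesis
    unfolding kern_def using DERIV_diff[OF *[of Y] *[of "reflect k Y"]] by (simp add: algebra_simps)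
qed

subsection \<open>Weighted means over half-balls\<close>

text \<open>\<open>B\<close> is a fixed box around all balls under consideration, so that
  \<open>r\<close> enters through the integrand alone. In the applications \<open>g\<close> is zero
  off the half-space, where \<open>kern\<close> is nonpositive.\<close>

definition weighted_mean :: "(real ^ 'n::finite) set \<Rightarrow> 'n \<Rightarrow> (real ^ 'n \<Rightarrow> real) \<Rightarrow> real ^ 'n \<Rightarrow> real \<Rightarrow> real" where
  "weighted_mean B k g Y r = integral B (\<lambda>Z. g Z * kern 2 k Y r Z / r ^ (CARD('n) + 4))"

text \<open>The exponent of \<open>r\<close> is chosen so that the derivative of the mean is an integral against the
  Laplacian of \<open>kern 3\<close>; its sign then comes from Green's identity.\<close>

lemma DERIV_weighted_mean:
  fixes g :: "real ^ 'n::finite \<Rightarrow> real"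
  assumes g: "continuous_on UNIV g" and r: "r > 0"
  shows "(weighted_mean (cbox p q) k g Y has_real_derivative
    integral (cbox p q) (\<lambda>Z. g Z * kern_lap k Y r Z) / (6 * r ^ (CARD('n) + 5))) (at r)"
proof -
  let ?n = "CARD('n)"
  have "((\<lambda>r. integral (cbox p q) (\<lambda>Z. g Z * kern 2 k Y r Z / r ^ (?n + 4))) has_real_derivative
    integral (cbox p q) (\<lambda>Z. g Z * kern_lap k Y r Z / (6 * r ^ (?n + 5)))) (at r within {0<..})"
  proof (rule leibniz_rule_field_derivative)
    fix r :: real and Z assume r: "r \<in> {0<..}"
    have "((\<lambda>r. g Z * kern 2 k Y r Z / r ^ (?n + 4)) has_real_derivative
      (g Z * (4 * r * kern 1 k Y r Z) * r ^ (?n + 4) - g Z * kern 2 k Y r Z * (real (?n + 4) * r ^ (?n + 3)))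
        / (r ^ (?n + 4) * r ^ (?n + 4))) (at r)"
      using r DERIV_pow[of "?n + 4" r] by (intro DERIV_divide DERIV_cmult DERIV_kern2) (auto simp: add.commute)
    also have "(g Z * (4 * r * kern 1 k Y r Z) * r ^ (?n + 4) - g Z * kern 2 k Y r Z * (real (?n + 4) * r ^ (?n + 3)))
        / (r ^ (?n + 4) * r ^ (?n + 4)) = g Z * kern_lap k Y r Z / (6 * r ^ (?n + 5))"
    proof -
      \<comment> \<open>The derivative of the power of \<open>r\<close> contributes
        \<open>6 * (CARD('n) + 4)\<close> after clearing denominators, which is exactly the
        coefficient of \<open>kern 2\<close> in \<open>kern_lap\<close>.\<close>
      have "(g Z * (4 * r * kern 1 k Y r Z) * r ^ (?n + 4) - g Z * kern 2 k Y r Z * (real (?n + 4) * r ^ (?n + 3)))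
        * (6 * r ^ (?n + 5)) = g Z * kern_lap k Y r Z * (r ^ (?n + 4) * r ^ (?n + 4))"
        unfolding kern_lap_def
        by (simp add: power_add numeral_eq_Suc algebra_simps)
      then show ?thesis using r by (subst frac_eq_eq) auto
    qed
    finally show "((\<lambda>r. g Z * kern 2 k Y r Z / r ^ (?n + 4)) has_field_derivative
      g Z * kern_lap k Y r Z / (6 * r ^ (?n + 5))) (at r within {0<..})"
      by (rule has_field_derivative_at_within)
  next
    fix r :: real assume r: "r \<in> {0<..}"
    show "(\<lambda>Z. g Z * kern 2 k Y r Z / r ^ (?n + 4)) integrable_on cbox p q"
      by (intro integrable_continuous continuous_intros continuous_on_kern continuous_on_subset[OF g])
         (use r in auto)
  next
    have "continuous_on ({0<..} \<times> cbox p q) (\<lambda>x. kern m k Y (fst x) (snd x))" for m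
      by (rule continuous_on_subset[OF continuous_on_kern_joint]) simp
    then show "continuous_on ({0<..} \<times> cbox p q) (\<lambda>(r, Z). g Z * kern_lap k Y r Z / (6 * r ^ (?n + 5)))"
      unfolding split_beta kern_lap_def
      by (intro continuous_intros continuous_on_compose2[OF g]) auto
  qed (use r in auto)
  then show ?thesis
    unfolding weighted_mean_def[abs_def] using r
    by (simp add: at_within_open[of r "{0<..}"])
qed

lemma open_half_space: "open (half_space k)"
  unfolding half_space_def by (rule open_Collect_less) (intro continuous_intros)+

lemma continuous_on_kern_lap: "continuous_on S (kern_lap k Y r)"
  unfolding kern_lap_def[abs_def] by (intro continuous_intros continuous_on_kern)

section \<open>Sign of the radial derivative of the means\<close>

text \<open>The support of \<open>kern 3\<close> reaches the boundary, where nothing is known about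
  derivatives of \<open>v\<close>. Green's identity is therefore applied to
  \<open>soft d (kern 3 k Y r Z)\<close>, which is supported compactly inside the half-space. The
  extra gradient term has the right sign because \<open>soft d\<close> is convex and
  \<open>v\<close> is nonnegative; then \<open>d\<close> tends to \<open>0\<close>.\<close>

lemma superharmonic_integral_kern_lap:
  fixes v :: "real ^ 'n::finite \<Rightarrow> real"
  assumes v: "has_pd2 (half_space k) v v1 v2"
    and nonneg: "\<And>Z. Z \<in> half_space k \<Longrightarrow> 0 \<le> v Z"
    and lap: "\<And>Z. Z \<in> half_space k \<Longrightarrow> (\<Sum>i\<in>UNIV. v2 i Z) \<le> 0"
    and cont: "continuous_on UNIV (\<lambda>Z. if Z \<in> half_space k then v Z else 0)"
    and Y: "Y \<in> half_space k" and r: "r > 0" and B: "cball Y r \<subseteq> cbox p q"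
  shows "integral (cbox p q) (\<lambda>Z. (if Z \<in> half_space k then v Z else 0) * kern_lap k Y r Z) \<le> 0"
proof -
  define g where "g = (\<lambda>Z. if Z \<in> half_space k then v Z else 0)"
  have Yk: "0 < Y $ k" using Y by (simp add: half_space_def)
  obtain b1 b2 where b: "has_pd2 UNIV (kern 3 k Y r) b1 b2"
    and b2: "\<And>Z. (\<Sum>i\<in>UNIV. b2 i Z) = kern_lap k Y r Z"
    using has_pd2_kern3[of k Y r] by blast
  have cg: "continuous_on UNIV g" using cont unfolding g_def .
  have c1: "continuous_on S (\<lambda>Z. soft1 d (kern 3 k Y r Z))" if "d > 0" for d S
    by (rule continuous_on_compose2[OF continuous_on_soft(2)[OF that] continuous_on_kern]) simp
  have int: "(\<lambda>Z. g Z * soft1 d (kern 3 k Y r Z) * kern_lap k Y r Z) integrable_on cbox p q" if "d > 0" for d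
    by (intro integrable_continuous continuous_intros c1[OF that] continuous_on_subset[OF cg]
        continuous_on_kern_lap) simp
  have le: "integral (cbox p q) (\<lambda>Z. g Z * soft1 d (kern 3 k Y r Z) * kern_lap k Y r Z) \<le> 0"
    if d: "d > 0" for d
  proof -
    \<comment> \<open>The superlevel set avoids the boundary because \<open>kern 3\<close> is
      nonpositive off the half-space; the ball makes it bounded.\<close>
    define K where "K = {Z. d \<le> kern 3 k Y r Z} \<inter> cball Y r"
    let ?b2 = "\<lambda>i Z. soft2 d (kern 3 k Y r Z) * (b1 i Z)\<^sup>2 + soft1 d (kern 3 k Y r Z) * b2 i Z"
    have "has_pd2 UNIV (\<lambda>Z. soft d (kern 3 k Y r Z)) (\<lambda>i Z. soft1 d (kern 3 k Y r Z) * b1 i Z) ?b2"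
      by (rule has_pd2_chain[OF b DERIV_soft[OF d] continuous_on_soft(3)[OF d]])
    then have bH: "has_pd2 (half_space k) (\<lambda>Z. soft d (kern 3 k Y r Z))
      (\<lambda>i Z. soft1 d (kern 3 k Y r Z) * b1 i Z) ?b2"
      by (rule has_pd2_subset) simp
    have "closed {Z. d \<le> kern 3 k Y r Z}"
      by (intro closed_Collect_le continuous_on_kern continuous_intros)
    then have K: "compact K" unfolding K_def by (intro closed_Int_compact) auto
    have KH: "K \<subseteq> half_space k"
    proof
      fix Z assume "Z \<in> K"
      then have "kern 3 k Y r Z > 0" using d by (simp add: K_def)
      then show "Z \<in> half_space k"
        using kern_nonpos[of Y k Z 3 r] Yk unfolding half_space_def by force
    qed
    have KB: "K \<subseteq> cbox p q" using B unfolding K_def by blast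
    have van: "v Z * soft d (kern 3 k Y r Z) = 0" if "Z \<in> half_space k - K" for Z
    proof -
      have "kern 3 k Y r Z \<le> d"
      proof (cases "Z \<in> cball Y r")
        case True
        then show ?thesis using that by (auto simp: K_def)
      next
        case False
        then have "r \<le> norm (Z - Y)" by (simp add: dist_norm norm_minus_commute)
        then show ?thesis
          using kern_eq_0[of Y k Z r 3] that Yk r d by (simp add: half_space_def)
      qed
      then show ?thesis by (simp add: soft_eq_0)
    qed
    show ?thesis
    proof (rule has_integral_le[OF integrable_integral[OF int[OF d]]
        Green_identity[OF v bH open_half_space K KH KB van]])
      fix Z
      show "g Z * soft1 d (kern 3 k Y r Z) * kern_lap k Y r Z \<le> (if Z \<in> half_space k
        then v Z * (\<Sum>i\<in>UNIV. ?b2 i Z) - soft d (kern 3 k Y r Z) * (\<Sum>i\<in>UNIV. v2 i Z) else 0)"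
      proof (cases "Z \<in> half_space k")
        case True
        have "(\<Sum>i\<in>UNIV. ?b2 i Z) =
          soft2 d (kern 3 k Y r Z) * (\<Sum>i\<in>UNIV. (b1 i Z)\<^sup>2) + soft1 d (kern 3 k Y r Z) * kern_lap k Y r Z"
          by (simp add: sum.distrib sum_distrib_left[symmetric] b2)
        moreover have "0 \<le> soft2 d (kern 3 k Y r Z) * (\<Sum>i\<in>UNIV. (b1 i Z)\<^sup>2)"
          using soft_bounds[OF d] by (intro mult_nonneg_nonneg sum_nonneg) auto
        ultimately have "v Z * (soft1 d (kern 3 k Y r Z) * kern_lap k Y r Z) \<le> v Z * (\<Sum>i\<in>UNIV. ?b2 i Z)"
          using nonneg[OF True] by (intro mult_left_mono) auto
        moreover have "soft d (kern 3 k Y r Z) * (\<Sum>i\<in>UNIV. v2 i Z) \<le> 0"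
          using lap[OF True] soft_bounds[OF d] by (intro mult_nonneg_nonpos) auto
        ultimately show ?thesis using True by (simp add: g_def mult.assoc)
      qed (simp add: g_def)
    qed
  qed
  \<comment> \<open>The factor \<open>soft1\<close> tends to \<open>1\<close> only where
    \<open>kern 3\<close> is positive, so the limit integrand has to vanish elsewhere. Inside the
    half-space \<open>kern 3\<close> fails to be positive only off the open ball, where
    \<open>kern 1\<close> and \<open>kern 2\<close> are zero as well.\<close>
  have kern_lap_0: "kern_lap k Y r Z = 0" if "Z \<in> half_space k" "kern 3 k Y r Z \<le> 0" for Z
  proof -
    have "r \<le> norm (Z - Y)"
      using kern_pos[of Y k Z r 3] that Yk by (force simp: half_space_def)
    then show ?thesis
      using kern_eq_0[of Y k Z r] that(1) Yk r by (simp add: half_space_def kern_lap_def)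
  qed
  have "(\<lambda>j. integral (cbox p q) (\<lambda>Z. g Z * soft1 (inverse (real (Suc j))) (kern 3 k Y r Z) * kern_lap k Y r Z))
    \<longlonglongrightarrow> integral (cbox p q) (\<lambda>Z. g Z * kern_lap k Y r Z)"
  proof (rule dominated_convergence(2))
    show "(\<lambda>Z. \<bar>g Z * kern_lap k Y r Z\<bar>) integrable_on cbox p q"
      by (intro integrable_continuous continuous_intros continuous_on_subset[OF cg] continuous_on_kern_lap) simp
    show "norm (g Z * soft1 (inverse (real (Suc j))) (kern 3 k Y r Z) * kern_lap k Y r Z) \<le> \<bar>g Z * kern_lap k Y r Z\<bar>" for j Z
    proof -
      have "\<bar>soft1 (inverse (real (Suc j))) (kern 3 k Y r Z)\<bar> \<le> 1"
        using soft_bounds(3,4)[of "inverse (real (Suc j))"] by simp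
      then have "\<bar>g Z * kern_lap k Y r Z\<bar> * \<bar>soft1 (inverse (real (Suc j))) (kern 3 k Y r Z)\<bar> \<le> \<bar>g Z * kern_lap k Y r Z\<bar>"
        by (intro mult_left_le) auto
      then show ?thesis by (simp add: abs_mult mult_ac)
    qed
    show "(\<lambda>j. g Z * soft1 (inverse (real (Suc j))) (kern 3 k Y r Z) * kern_lap k Y r Z)
      \<longlonglongrightarrow> g Z * kern_lap k Y r Z" for Z
    proof (cases "kern 3 k Y r Z > 0")
      case True
      have "(\<lambda>j. g Z * soft1 (inverse (real (Suc j))) (kern 3 k Y r Z) * kern_lap k Y r Z)
        \<longlonglongrightarrow> g Z * 1 * kern_lap k Y r Z"
        by (intro tendsto_intros soft1_tendsto True)
      then show ?thesis by simp
    next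
      case False
      then have "g Z * kern_lap k Y r Z = 0"
        using kern_lap_0[of Z] by (auto simp: g_def)
      then show ?thesis by (auto simp: mult_ac)
    qed
  qed (rule int, simp)
  then have "integral (cbox p q) (\<lambda>Z. g Z * kern_lap k Y r Z) \<le> 0"
    by (rule LIMSEQ_le_const2) (use le in auto)
  then show ?thesis unfolding g_def .
qed

text \<open>Since \<open>C\<close> is closed and contained in the open half-space, its part in the
  ball is compact. Green's identity thus applies to \<open>kern 3\<close> itself, and its
  nonnegativity settles the sign.\<close>

lemma subharmonic_integral_kern_lap:
  fixes w :: "real ^ 'n::finite \<Rightarrow> real"
  assumes w: "has_pd2 (half_space k) w w1 w2"
    and lap: "\<And>Z. Z \<in> half_space k \<Longrightarrow> 0 \<le> (\<Sum>i\<in>UNIV. w2 i Z)"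
    and cont: "continuous_on UNIV (\<lambda>Z. if Z \<in> half_space k then w Z else 0)"
    and C: "closed C" "C \<subseteq> half_space k" "\<And>Z. Z \<in> half_space k - C \<Longrightarrow> w Z = 0"
    and Y: "Y \<in> half_space k" and r: "r > 0" and B: "cball Y r \<subseteq> cbox p q"
  shows "0 \<le> integral (cbox p q) (\<lambda>Z. (if Z \<in> half_space k then w Z else 0) * kern_lap k Y r Z)"
proof -
  define g where "g = (\<lambda>Z. if Z \<in> half_space k then w Z else 0)"
  have Yk: "0 < Y $ k" using Y by (simp add: half_space_def)
  obtain b1 b2 where "has_pd2 UNIV (kern 3 k Y r) b1 b2"
    and b2: "\<And>Z. (\<Sum>i\<in>UNIV. b2 i Z) = kern_lap k Y r Z"
    using has_pd2_kern3[of k Y r] by blast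
  then have b: "has_pd2 (half_space k) (kern 3 k Y r) b1 b2"
    using has_pd2_subset by blast
  have cg: "continuous_on UNIV g" using cont unfolding g_def .
  have int: "(\<lambda>Z. g Z * kern_lap k Y r Z) integrable_on cbox p q"
    by (intro integrable_continuous continuous_intros continuous_on_subset[OF cg] continuous_on_kern_lap) simp
  define K where "K = C \<inter> cball Y r"
  have K: "compact K" "K \<subseteq> half_space k" "K \<subseteq> cbox p q"
    using C(1,2) B unfolding K_def by (auto intro: closed_Int_compact)
  have van: "w Z * kern 3 k Y r Z = 0" if "Z \<in> half_space k - K" for Z
  proof (cases "Z \<in> cball Y r")
    case True
    then show ?thesis using that C(3) by (simp add: K_def)
  next
    case False
    then have "r \<le> norm (Z - Y)" by (simp add: dist_norm norm_minus_commute)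
    then show ?thesis
      using kern_eq_0[of Y k Z r 3] that Yk r by (simp add: half_space_def)
  qed
  have "0 \<le> integral (cbox p q) (\<lambda>Z. g Z * kern_lap k Y r Z)"
  proof (rule has_integral_le[OF Green_identity[OF w b open_half_space K van] integrable_integral[OF int]])
    fix Z
    show "(if Z \<in> half_space k then w Z * (\<Sum>i\<in>UNIV. b2 i Z) - kern 3 k Y r Z * (\<Sum>i\<in>UNIV. w2 i Z) else 0)
      \<le> g Z * kern_lap k Y r Z"
    proof (cases "Z \<in> half_space k")
      case True
      then have "0 \<le> kern 3 k Y r Z * (\<Sum>i\<in>UNIV. w2 i Z)"
        using lap[OF True] kern_nonneg[of Y k Z] Yk by (simp add: half_space_def)
      then show ?thesis using True by (simp add: g_def b2)
    qed (simp add: g_def)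
  qed
  then show ?thesis unfolding g_def .
qed

lemma weighted_mean_mono:
  fixes g :: "real ^ 'n::finite \<Rightarrow> real"
  assumes "continuous_on UNIV g" "0 < r" "r \<le> R"
    and "\<And>s. r \<le> s \<Longrightarrow> s \<le> R \<Longrightarrow> 0 \<le> integral (cbox p q) (\<lambda>Z. g Z * kern_lap k Y s Z)"
  shows "weighted_mean (cbox p q) k g Y r \<le> weighted_mean (cbox p q) k g Y R"
proof (rule DERIV_nonneg_imp_nondecreasing[OF assms(3)])
  fix s assume s: "r \<le> s" "s \<le> R"
  then have "s > 0" using assms(2) by simp
  then show "\<exists>y. (weighted_mean (cbox p q) k g Y has_real_derivative y) (at s) \<and> 0 \<le> y"
    using DERIV_weighted_mean[OF assms(1), of s p q k Y] assms(4)[OF s]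
    by (intro exI[of _ "integral (cbox p q) (\<lambda>Z. g Z * kern_lap k Y s Z) / (6 * s ^ (CARD('n) + 5))"])
       (auto)
qed

lemma weighted_mean_antimono:
  fixes g :: "real ^ 'n::finite \<Rightarrow> real"
  assumes "continuous_on UNIV g" "0 < r" "r \<le> R"
    and "\<And>s. r \<le> s \<Longrightarrow> s \<le> R \<Longrightarrow> integral (cbox p q) (\<lambda>Z. g Z * kern_lap k Y s Z) \<le> 0"
  shows "weighted_mean (cbox p q) k g Y R \<le> weighted_mean (cbox p q) k g Y r"
proof (rule DERIV_nonpos_imp_nonincreasing[OF assms(3)])
  fix s assume s: "r \<le> s" "s \<le> R"
  then have "s > 0" using assms(2) by simp
  then show "\<exists>y. (weighted_mean (cbox p q) k g Y has_real_derivative y) (at s) \<and> y \<le> 0"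
    using DERIV_weighted_mean[OF assms(1), of s p q k Y] assms(4)[OF s]
    by (intro exI[of _ "integral (cbox p q) (\<lambda>Z. g Z * kern_lap k Y s Z) / (6 * s ^ (CARD('n) + 5))"])
       (auto intro!: divide_nonpos_pos)
qed

section \<open>Means over small balls\<close>

text \<open>The type argument carries the dimension. The mass does not depend on the centre, so it
  cancels when means about two different points are compared at the same radius.\<close>

definition bump_mass :: "'n::finite itself \<Rightarrow> real \<Rightarrow> real" where
  "bump_mass _ r = integral UNIV (bump 2 (0 :: real ^ 'n) r)"

lemma bump_eq_0: "0 \<le> r \<Longrightarrow> r \<le> norm (Z - Y) \<Longrightarrow> m > 0 \<Longrightarrow> bump m Y r Z = 0"
  using power_mono[of r "norm (Z - Y)" 2] by (simp add: bump_def max_def)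

lemma continuous_on_bump: "continuous_on S (bump m Y r)"
  unfolding bump_def[abs_def] by (intro continuous_intros)

lemma has_integral_bump:
  fixes Y :: "real ^ 'n::finite"
  assumes "0 \<le> r" "cball Y r \<subseteq> cbox p q"
  shows "(bump 2 Y r has_integral bump_mass TYPE('n) r) (cbox p q)"
proof -
  have i: "(bump 2 Y r has_integral integral (cbox p q) (bump 2 Y r)) (cbox p q)"
    by (intro integrable_integral integrable_continuous continuous_on_bump)
  have "((\<lambda>Z. bump 2 Y r (Z + Y)) has_integral integral (cbox p q) (bump 2 Y r)) (cbox (p - Y) (q - Y))"
    by (rule has_integral_shift_cbox[OF i])
  moreover have "bump 2 Y r (Z + Y) = bump 2 0 r Z" for Z
    by (simp add: bump_def)
  ultimately have i0: "(bump 2 0 r has_integral integral (cbox p q) (bump 2 Y r)) (cbox (p - Y) (q - Y))"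
    by simp
  have out: "bump 2 0 r Z = 0" if "Z \<notin> cbox (p - Y) (q - Y)" for Z
  proof -
    have "Z + Y \<notin> cbox p q" using that by (auto simp: mem_box_cart algebra_simps)
    then have "Z + Y \<notin> cball Y r" using assms(2) by blast
    then show ?thesis using assms(1) by (intro bump_eq_0) (auto simp: dist_norm)
  qed
  have "(bump 2 (0 :: real ^ 'n) r has_integral integral (cbox p q) (bump 2 Y r)) UNIV"
    by (rule has_integral_on_superset[OF i0 out]) simp_all
  then have "bump_mass TYPE('n) r = integral (cbox p q) (bump 2 Y r)"
    unfolding bump_mass_def by (rule integral_unique)
  with i show ?thesis by simp
qed

lemma bump_mass_pos:
  assumes "r > 0"
  shows "bump_mass TYPE('n::finite) r > 0"
proof -
  let ?b = "bump 2 (0 :: real ^ 'n) r"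
  obtain a :: "real ^ 'n" where a: "cball 0 r \<subseteq> cbox (- a) a"
    using bounded_subset_cbox_symmetric[OF bounded_cball] by blast
  have int: "(?b has_integral bump_mass TYPE('n) r) (cbox (- a) a)"
    using has_integral_bump[OF _ a] assms by simp
  have "ball 0 r \<subseteq> cbox (- a) a"
    using a by force
  then have "ball 0 r \<subseteq> box (- a) a"
    using interior_maximal[of "ball 0 r" "cbox (- a) a"] by simp
  then have ne: "0 \<in> box (- a) a" using assms by auto
  have "integral (cbox (- a) a) ?b \<noteq> 0"
  proof
    assume "integral (cbox (- a) a) ?b = 0"
    moreover have "box (- a) a \<noteq> {}" using ne by blast
    ultimately have "\<forall>Z\<in>cbox (- a) a. ?b Z = 0"
      using integral_cbox_eq_0_iff[OF continuous_on_bump, of "- a" a 2 0 r] by (simp add: bump_def)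
    then have "?b 0 = 0" using ne box_subset_cbox[of "- a" a] by blast
    then show False using assms by (simp add: bump_def)
  qed
  moreover have "0 \<le> bump_mass TYPE('n) r"
    by (rule has_integral_nonneg[OF int]) (simp add: bump_def)
  ultimately show ?thesis using integral_unique[OF int] by simp
qed

text \<open>For \<open>r < Y $ k\<close> the ball about the mirror image misses the half-space.
  Hence \<open>kern 2\<close> equals the plain bump wherever \<open>g\<close> can be nonzero, and
  the bounds are those of an ordinary average.\<close>

lemma weighted_mean_small_radius:
  fixes g :: "real ^ 'n::finite \<Rightarrow> real"
  assumes g: "continuous_on UNIV g" "\<And>Z. Z \<notin> half_space k \<Longrightarrow> g Z = 0"
    and r: "0 < r" "r < Y $ k" and B: "cball Y r \<subseteq> cbox p q"
  shows "(\<And>Z. Z \<in> cball Y r \<Longrightarrow> c \<le> g Z) \<Longrightarrow>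
      c * bump_mass TYPE('n) r \<le> r ^ (CARD('n) + 4) * weighted_mean (cbox p q) k g Y r"
    and "(\<And>Z. Z \<in> cball Y r \<Longrightarrow> g Z \<le> c) \<Longrightarrow>
      r ^ (CARD('n) + 4) * weighted_mean (cbox p q) k g Y r \<le> c * bump_mass TYPE('n) r"
proof -
  have kern: "g Z * kern 2 k Y r Z = g Z * bump 2 Y r Z" for Z
  proof (cases "Z \<in> half_space k")
    case True
    have "\<bar>(Z - reflect k Y) $ k\<bar> \<le> norm (Z - reflect k Y)"
      by (rule component_le_norm_cart)
    then have "r \<le> norm (Z - reflect k Y)"
      using True r by (simp add: half_space_def reflect_def)
    then show ?thesis
      using bump_eq_0[of r Z "reflect k Y" 2] r by (simp add: kern_def)
  qed (simp add: g)
  have "(\<lambda>Z. g Z * bump 2 Y r Z) integrable_on cbox p q"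
    by (intro integrable_continuous continuous_intros continuous_on_subset[OF g(1)] continuous_on_bump) simp
  then have i: "((\<lambda>Z. g Z * bump 2 Y r Z) has_integral integral (cbox p q) (\<lambda>Z. g Z * bump 2 Y r Z)) (cbox p q)"
    by (rule integrable_integral)
  have wm: "r ^ (CARD('n) + 4) * weighted_mean (cbox p q) k g Y r = integral (cbox p q) (\<lambda>Z. g Z * bump 2 Y r Z)"
    unfolding weighted_mean_def using r by (simp add: kern)
  have c: "((\<lambda>Z. c * bump 2 Y r Z) has_integral c * bump_mass TYPE('n) r) (cbox p q)"
    using has_integral_mult_right[OF has_integral_bump[OF _ B]] r by simp
  have out: "bump 2 Y r Z = 0" if "Z \<notin> cball Y r" for Z
    using that r by (intro bump_eq_0) (auto simp: dist_norm norm_minus_commute)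
  have nn: "0 \<le> bump 2 Y r Z" for Z by (simp add: bump_def)
  show "c * bump_mass TYPE('n) r \<le> r ^ (CARD('n) + 4) * weighted_mean (cbox p q) k g Y r"
    if "\<And>Z. Z \<in> cball Y r \<Longrightarrow> c \<le> g Z"
    unfolding wm
  proof (rule has_integral_le[OF c i])
    show "c * bump 2 Y r Z \<le> g Z * bump 2 Y r Z" for Z
      using that out nn by (cases "Z \<in> cball Y r") (auto intro: mult_right_mono)
  qed
  show "r ^ (CARD('n) + 4) * weighted_mean (cbox p q) k g Y r \<le> c * bump_mass TYPE('n) r"
    if "\<And>Z. Z \<in> cball Y r \<Longrightarrow> g Z \<le> c"
    unfolding wm
  proof (rule has_integral_le[OF i c])
    show "g Z * bump 2 Y r Z \<le> c * bump 2 Y r Z" for Z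
      using that out nn by (cases "Z \<in> cball Y r") (auto intro: mult_right_mono)
  qed
qed

section \<open>Comparison of means about different centres\<close>

text \<open>Both kernels are differences of squares, and the gaps between the untruncated arguments
  are \<open>4 * Z $ k\<close> times \<open>X $ k\<close> and \<open>Y $ k\<close> respectively. The
  accompanying sum is at most \<open>2 * R\<^sup>2\<close> for the small ball; for the ball of
  radius \<open>2 * R\<close> it is at least that, as \<open>Z\<close> lies well inside it.\<close>

lemma kern2_compare:
  assumes "0 < X $ k" "0 < Y $ k" "0 < Z $ k" "0 < R" "2 * norm (X - reflect k Y) \<le> R"
  shows "Y $ k * kern 2 k X R Z \<le> X $ k * kern 2 k Y (2 * R) Z"
proof (cases "norm (Z - X) < R")
  case True
  define s where "s = R\<^sup>2 - (norm (Z - X))\<^sup>2"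
  define s' where "s' = (2 * R)\<^sup>2 - (norm (Z - Y))\<^sup>2"
  define a where "a = 4 * Z $ k * X $ k"
  define b where "b = 4 * Z $ k * Y $ k"
  have ab: "0 < a" "0 < b" using assms by (simp_all add: a_def b_def)
  have s: "0 < s" "s \<le> R\<^sup>2" using True by (simp_all add: s_def power_strict_mono)
  have "norm (Z - reflect k Y) \<le> norm (Z - X) + norm (X - reflect k Y)"
    using norm_triangle_ineq[of "Z - X" "X - reflect k Y"] by simp
  \<comment> \<open>Since \<open>4 - 9 / 4 \<ge> 1\<close>, the argument of the reflected bump of
    radius \<open>2 * R\<close> stays above \<open>R\<^sup>2\<close>, and neither truncation is
    active.\<close>
  then have "norm (Z - reflect k Y) \<le> 3 / 2 * R" using True assms(5) by linarith
  then have "(norm (Z - reflect k Y))\<^sup>2 \<le> (3 / 2 * R)\<^sup>2" by (intro power_mono) auto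
  then have n: "(norm (Z - Y))\<^sup>2 + b \<le> 9 / 4 * R\<^sup>2"
    unfolding norm_diff_reflect b_def by (simp add: power_divide power_mult_distrib)
  have R: "0 < R\<^sup>2" using assms(4) by simp
  have "s' = 4 * R\<^sup>2 - (norm (Z - Y))\<^sup>2" by (simp add: s'_def)
  with n R have s': "R\<^sup>2 \<le> s' - b" by linarith
  have X: "kern 2 k X R Z = (max 0 s)\<^sup>2 - (max 0 (s - a))\<^sup>2"
    unfolding kern_def bump_def norm_diff_reflect s_def a_def by (simp add: algebra_simps)
  have Y: "kern 2 k Y (2 * R) Z = (max 0 s')\<^sup>2 - (max 0 (s' - b))\<^sup>2"
    unfolding kern_def bump_def norm_diff_reflect s'_def b_def by (simp add: algebra_simps)
  have "kern 2 k X R Z \<le> a * (2 * R\<^sup>2)"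
  proof -
    have "kern 2 k X R Z = (max 0 s - max 0 (s - a)) * (max 0 s + max 0 (s - a))"
      unfolding X by algebra
    also have "\<dots> \<le> a * (2 * R\<^sup>2)"
      using s ab by (intro mult_mono) linarith+
    finally show ?thesis .
  qed
  moreover have "b * (2 * R\<^sup>2) \<le> kern 2 k Y (2 * R) Z"
  proof -
    have "b * (2 * R\<^sup>2) \<le> b * (s' + (s' - b))"
      using ab s' by (intro mult_left_mono) linarith+
    also have "\<dots> = kern 2 k Y (2 * R) Z"
      unfolding Y using s' ab R by (simp add: max_def power2_eq_square algebra_simps)
    finally show ?thesis .
  qed
  ultimately have "Y $ k * kern 2 k X R Z \<le> Y $ k * (a * (2 * R\<^sup>2))"
    "X $ k * (b * (2 * R\<^sup>2)) \<le> X $ k * kern 2 k Y (2 * R) Z"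
    using assms(1,2) by (auto intro!: mult_left_mono simp del: mult_le_cancel_left_pos)
  moreover have "Y $ k * (a * (2 * R\<^sup>2)) = X $ k * (b * (2 * R\<^sup>2))"
    by (simp add: a_def b_def)
  ultimately show ?thesis by linarith
next
  case False
  then have "kern 2 k X R Z = 0"
    using kern_eq_0[of X k Z R 2] assms by simp
  then show ?thesis
    using kern_nonneg[of Y k Z 2 "2 * R"] assms by simp
qed

text \<open>The value \<open>w X\<close> is controlled by a mean of \<open>w\<close> over a small
  ball about \<open>X\<close>, and this mean increases up to radius \<open>R\<close>. There
  \<open>w \<le> v\<close> and \<open>kern2_compare\<close> pass to the mean of \<open>v\<close>
  about \<open>Y\<close> of radius \<open>2 * R\<close>, which increases as the radius shrinks and
  so is controlled by \<open>v Y\<close>. The power of \<open>2\<close> is the ratio of the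
  normalising factors at \<open>2 * R\<close> and \<open>R\<close>.\<close>

lemma boundary_comparison:
  fixes v w :: "real ^ 'n::finite \<Rightarrow> real"
  assumes w: "has_pd2 (half_space k) w w1 w2"
    and lap_w: "\<And>Z. Z \<in> half_space k \<Longrightarrow> 0 \<le> (\<Sum>i\<in>UNIV. w2 i Z)"
    and cont_w: "continuous_on UNIV (\<lambda>Z. if Z \<in> half_space k then w Z else 0)"
    and C: "closed C" "C \<subseteq> half_space k" "\<And>Z. Z \<in> half_space k - C \<Longrightarrow> w Z = 0"
    and v: "has_pd2 (half_space k) v v1 v2"
    and lap_v: "\<And>Z. Z \<in> half_space k \<Longrightarrow> (\<Sum>i\<in>UNIV. v2 i Z) \<le> 0"
    and cont_v: "continuous_on UNIV (\<lambda>Z. if Z \<in> half_space k then v Z else 0)"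
    and nonneg: "\<And>Z. Z \<in> half_space k \<Longrightarrow> 0 \<le> v Z"
    and wv: "\<And>Z. Z \<in> half_space k \<Longrightarrow> w Z \<le> v Z"
    and X: "X \<in> half_space k" and Y: "Y \<in> half_space k"
  shows "w X * Y $ k \<le> 2 ^ (CARD('n) + 4) * v Y * X $ k"
proof -
  let ?m = "CARD('n) + 4"
  define gw where "gw = (\<lambda>Z. if Z \<in> half_space k then w Z else 0)"
  define gv where "gv = (\<lambda>Z. if Z \<in> half_space k then v Z else 0)"
  have cgw: "continuous_on UNIV gw" and cgv: "continuous_on UNIV gv"
    using cont_w cont_v by (simp_all add: gw_def gv_def)
  have Xk: "0 < X $ k" and Yk: "0 < Y $ k" using X Y by (simp_all add: half_space_def)
  define R where "R = 1 + 2 * norm (X - reflect k Y)"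
  have R: "0 < R" "2 * norm (X - reflect k Y) \<le> R"
    using norm_ge_zero[of "X - reflect k Y"] unfolding R_def by linarith+
  obtain a where a: "cball X R \<union> cball Y (2 * R) \<subseteq> cbox (- a) a"
    using bounded_subset_cbox_symmetric[of "cball X R \<union> cball Y (2 * R)"] by auto
  let ?B = "cbox (- a) a"
  have aX: "cball X s \<subseteq> ?B" if "s \<le> R" for s
    using a that subset_cball[of s R X] by blast
  have aY: "cball Y s \<subseteq> ?B" if "s \<le> 2 * R" for s
    using a that subset_cball[of s "2 * R" Y] by blast
  have large: "weighted_mean ?B k gw X R * Y $ k \<le> 2 ^ ?m * weighted_mean ?B k gv Y (2 * R) * X $ k"
  proof -
    have "Y $ k * weighted_mean ?B k gw X R = integral ?B (\<lambda>Z. Y $ k * (gw Z * kern 2 k X R Z / R ^ ?m))"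
      by (simp add: weighted_mean_def)
    also have "\<dots> \<le> integral ?B (\<lambda>Z. (2 ^ ?m * X $ k) * (gv Z * kern 2 k Y (2 * R) Z / (2 * R) ^ ?m))"
    proof (rule integral_le)
      show "(\<lambda>Z. Y $ k * (gw Z * kern 2 k X R Z / R ^ ?m)) integrable_on ?B"
        by (intro integrable_continuous continuous_intros continuous_on_subset[OF cgw] continuous_on_kern)
           (use R in auto)
      show "(\<lambda>Z. (2 ^ ?m * X $ k) * (gv Z * kern 2 k Y (2 * R) Z / (2 * R) ^ ?m)) integrable_on ?B"
        by (intro integrable_continuous continuous_intros continuous_on_subset[OF cgv] continuous_on_kern)
           (use R in auto)
      fix Z
      have "gw Z * (Y $ k * kern 2 k X R Z) \<le> gv Z * (X $ k * kern 2 k Y (2 * R) Z)"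
      proof (cases "Z \<in> half_space k")
        case True
        then have "0 < Z $ k" by (simp add: half_space_def)
        then show ?thesis
          using True wv[OF True] nonneg[OF True] kern2_compare[OF Xk Yk _ R] kern_nonneg[of X k Z 2 R] Xk Yk
          unfolding gw_def gv_def by (simp add: mult_mono')
             (meson mult_left_mono mult_right_mono order_trans mult_nonneg_nonneg less_imp_le)
      qed (simp add: gw_def gv_def)
      then have "gw Z * (Y $ k * kern 2 k X R Z) / R ^ ?m \<le> gv Z * (X $ k * kern 2 k Y (2 * R) Z) / R ^ ?m"
        using R(1) by (intro divide_right_mono) auto
      then show "Y $ k * (gw Z * kern 2 k X R Z / R ^ ?m)
        \<le> (2 ^ ?m * X $ k) * (gv Z * kern 2 k Y (2 * R) Z / (2 * R) ^ ?m)"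
        unfolding power_mult_distrib using R(1) by (simp add: mult_ac)
    qed
    also have "\<dots> = 2 ^ ?m * X $ k * weighted_mean ?B k gv Y (2 * R)"
      by (simp only: weighted_mean_def integral_mult_right)
    finally show ?thesis by (simp only: mult_ac)
  qed
  have eps: "(w X - e) * Y $ k \<le> 2 ^ ?m * (v Y + e) * X $ k" if e: "e > 0" for e
  proof -
    have "isCont gw X" "isCont gv Y"
      using cgw cgv by (simp_all add: continuous_on_eq_continuous_at)
    then have "\<exists>d>0. \<forall>Z. dist Z X < d \<longrightarrow> dist (gw Z) (gw X) < e"
      "\<exists>d>0. \<forall>Z. dist Z Y < d \<longrightarrow> dist (gv Z) (gv Y) < e"
      using e by (simp_all add: continuous_at_eps_delta)
    then obtain d1 d2 where d1: "d1 > 0" "\<And>Z. dist Z X < d1 \<Longrightarrow> dist (gw Z) (gw X) < e"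
      and d2: "d2 > 0" "\<And>Z. dist Z Y < d2 \<Longrightarrow> dist (gv Z) (gv Y) < e"
      by auto
    \<comment> \<open>Below both continuity radii, below both heights as
      \<open>weighted_mean_small_radius\<close> demands, and at most \<open>R\<close>. A common
      radius for the two points lets \<open>bump_mass\<close> cancel.\<close>
    define r where "r = min (min (d1 / 2) (d2 / 2)) (min (min (X $ k / 2) (Y $ k / 2)) R)"
    have r: "0 < r" "r < d1" "r < d2" "r < X $ k" "r < Y $ k" "r \<le> R"
      using d1(1) d2(1) Xk Yk R(1) unfolding r_def by linarith+
    have gX: "gw X = w X" and gY: "gv Y = v Y" using X Y by (simp_all add: gw_def gv_def)
    have "(w X - e) * bump_mass TYPE('n) r \<le> r ^ ?m * weighted_mean ?B k gw X r"
    proof (rule weighted_mean_small_radius(1)[OF cgw _ r(1,4) aX[OF r(6)]])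
      show "w X - e \<le> gw Z" if "Z \<in> cball X r" for Z
        using d1(2)[of Z] that r(2) by (simp add: gX dist_commute dist_real_def)
    qed (simp add: gw_def)
    also have "\<dots> \<le> r ^ ?m * weighted_mean ?B k gw X R"
    proof (intro mult_left_mono weighted_mean_mono cgw r(1,6))
      fix s assume "r \<le> s" "s \<le> R"
      then show "0 \<le> integral ?B (\<lambda>Z. gw Z * kern_lap k X s Z)"
        using subharmonic_integral_kern_lap[OF w lap_w cont_w C X _ aX] r(1)
        unfolding gw_def by simp
    qed (use r(1) in simp)
    finally have 1: "(w X - e) * bump_mass TYPE('n) r \<le> r ^ ?m * weighted_mean ?B k gw X R" .
    have "r ^ ?m * weighted_mean ?B k gv Y (2 * R) \<le> r ^ ?m * weighted_mean ?B k gv Y r"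
    proof (intro mult_left_mono weighted_mean_antimono cgv r(1))
      fix s assume "r \<le> s" "s \<le> 2 * R"
      then show "integral ?B (\<lambda>Z. gv Z * kern_lap k Y s Z) \<le> 0"
        using superharmonic_integral_kern_lap[OF v nonneg lap_v cont_v Y _ aY] r(1)
        unfolding gv_def by simp
    qed (use r(1,6) in simp_all)
    also have "\<dots> \<le> (v Y + e) * bump_mass TYPE('n) r"
    proof (rule weighted_mean_small_radius(2)[OF cgv _ r(1,5) aY])
      show "gv Z \<le> v Y + e" if "Z \<in> cball Y r" for Z
        using d2(2)[of Z] that r(3) by (simp add: gY dist_commute dist_real_def)
    qed (use r in \<open>simp_all add: gv_def\<close>)
    finally have 2: "r ^ ?m * weighted_mean ?B k gv Y (2 * R) \<le> (v Y + e) * bump_mass TYPE('n) r" .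
    have "(w X - e) * bump_mass TYPE('n) r * Y $ k \<le> r ^ ?m * (weighted_mean ?B k gw X R * Y $ k)"
      using mult_right_mono[OF 1, of "Y $ k"] Yk by (simp add: mult_ac)
    also have "\<dots> \<le> r ^ ?m * (2 ^ ?m * weighted_mean ?B k gv Y (2 * R) * X $ k)"
      using large r(1) by (intro mult_left_mono) auto
    also have "\<dots> = 2 ^ ?m * X $ k * (r ^ ?m * weighted_mean ?B k gv Y (2 * R))"
      by (simp only: mult_ac)
    also have "\<dots> \<le> 2 ^ ?m * X $ k * ((v Y + e) * bump_mass TYPE('n) r)"
      using 2 Xk by (intro mult_left_mono) auto
    finally have "((w X - e) * Y $ k) * bump_mass TYPE('n) r \<le> (2 ^ ?m * (v Y + e) * X $ k) * bump_mass TYPE('n) r"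
      by (simp only: mult_ac)
    then show ?thesis
      using bump_mass_pos[OF r(1), where 'n = 'n] by (simp only: mult_le_cancel_right_pos)
  qed
  show ?thesis
  proof (rule tendsto_le)
    show "((\<lambda>e. (w X - e) * Y $ k) \<longlongrightarrow> w X * Y $ k) (at_right 0)"
      by (rule tendsto_eq_intros refl | simp)+
    show "((\<lambda>e. 2 ^ ?m * (v Y + e) * X $ k) \<longlongrightarrow> 2 ^ ?m * v Y * X $ k) (at_right 0)"
      by (rule tendsto_eq_intros refl | simp)+
    show "\<forall>\<^sub>F e in at_right 0. (w X - e) * Y $ k \<le> 2 ^ ?m * (v Y + e) * X $ k"
      using eps by (auto simp: eventually_at_filter)
  qed simp
qed

subsection \<open>Symmetry of solutions\<close>

lemma closure_half_space: "closure (half_space k) = {Z. 0 \<le> Z $ k}"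
  and frontier_half_space: "frontier (half_space k) = {Z. Z $ k = 0}"
proof -
  have eq: "half_space k = {Z. axis k (1::real) \<bullet> Z > 0}"
    by (simp add: half_space_def inner_axis')
  have "axis k (1::real) \<noteq> 0" by (simp add: axis_eq_0_iff)
  then show "closure (half_space k) = {Z. 0 \<le> Z $ k}" "frontier (half_space k) = {Z. Z $ k = 0}"
    unfolding eq using closure_halfspace_gt[of "axis k (1::real)" 0] frontier_halfspace_gt[of "axis k (1::real)" 0]
    by (auto simp: inner_axis')
qed

lemma continuous_on_half_space_extend_0:
  fixes \<phi> :: "real ^ 'n::finite \<Rightarrow> real"
  assumes "continuous_on (closure (half_space k)) \<phi>" "\<And>Z. Z $ k = 0 \<Longrightarrow> \<phi> Z = 0"
  shows "continuous_on UNIV (\<lambda>Z. if Z \<in> half_space k then \<phi> Z else 0)"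
proof -
  have "closed {Z :: real ^ 'n. Z $ k \<le> 0}"
    by (intro closed_Collect_le continuous_intros)
  then have "continuous_on (closure (half_space k) \<union> {Z. Z $ k \<le> 0}) (\<lambda>Z. if Z \<in> half_space k then \<phi> Z else 0)"
    using closed_closure[of "half_space k"]
    by (intro continuous_on_If) (use assms in \<open>auto simp: half_space_def closure_half_space\<close>)
  moreover have "closure (half_space k) \<union> {Z :: real ^ 'n. Z $ k \<le> 0} = UNIV"
    by (auto simp: closure_half_space)
  ultimately show ?thesis by simp
qed

text \<open>Here \<open>c\<close> is the largest constant with \<open>c * Z $ k \<le> u Z\<close>
  throughout. A positive value of the truncated difference at \<open>X\<close> would, through
  \<open>boundary_comparison\<close>, raise this constant by some
  \<open>\<delta> > 0\<close>.\<close>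

lemma solution_le_translate:
  fixes u :: "real ^ 'n::finite \<Rightarrow> real"
  assumes sol: "global_solution k \<gamma> f u" and \<gamma>: "\<gamma> > 0" and f: "\<And>t. t > 0 \<Longrightarrow> 0 \<le> f t"
    and h: "h $ k = 0" and X: "X \<in> half_space k"
  shows "u X \<le> u (X + h)"
proof -
  let ?H = "half_space k"
  let ?u1 = "\<lambda>i. partial_deriv i u" and ?u2 = "\<lambda>i. partial_deriv i (partial_deriv i u)"
  have u: "has_pd2 ?H u ?u1 ?u2" and cont: "continuous_on (closure ?H) u"
    and pos: "\<And>Z. Z \<in> ?H \<Longrightarrow> 0 < u Z"
    and lap: "\<And>Z. Z \<in> ?H \<Longrightarrow> (\<Sum>i\<in>UNIV. ?u2 i Z) = - (f (Z $ k) * u Z powr (- \<gamma>))"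
    and bdry: "\<And>Z. Z $ k = 0 \<Longrightarrow> u Z = 0"
    using sol C2_on_imp_has_pd2[of ?H u]
    by (auto simp: global_solution_def laplacian_def frontier_half_space minus_equation_iff)
  have shift: "Z + h \<in> ?H \<longleftrightarrow> Z \<in> ?H" for Z using h by (simp add: half_space_def)
  define c where "c = (INF Z\<in>?H. u Z / Z $ k)"
  have nn: "0 \<le> u Z / Z $ k" if "Z \<in> ?H" for Z
    using pos[OF that] that by (simp add: half_space_def)
  then have bdd: "bdd_below ((\<lambda>Z. u Z / Z $ k) ` ?H)" by (rule bdd_belowI2)
  have ne: "?H \<noteq> {}" using X by blast
  have c_le: "c * Z $ k \<le> u Z" if "Z \<in> ?H" for Z
    using cINF_lower[OF bdd that] that by (simp add: c_def half_space_def pos_le_divide_eq)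
  have v: "has_pd2 ?H (\<lambda>Z. u Z - c * Z $ k) (\<lambda>i Z. ?u1 i Z - (if k = i then c else 0)) (\<lambda>i Z. ?u2 i Z - 0)"
    by (rule has_pd2_diff[OF u has_pd2_linear])
  have cont_v: "continuous_on UNIV (\<lambda>Z. if Z \<in> ?H then u Z - c * Z $ k else 0)"
    by (intro continuous_on_half_space_extend_0 continuous_intros cont) (simp add: bdry)
  \<comment> \<open>The positive part of the difference is replaced by \<open>soft d\<close>, which
    is smooth enough and vanishes near the boundary; every \<open>d > 0\<close> is treated
    separately.\<close>
  have le_d: "u X - u (X + h) \<le> d" if d: "d > 0" for d
  proof -
    let ?t = "\<lambda>Z. u Z - u (Z + h)"
    let ?w = "\<lambda>Z. soft d (?t Z)"
    have t: "has_pd2 ?H ?t (\<lambda>i Z. ?u1 i Z - ?u1 i (Z + h)) (\<lambda>i Z. ?u2 i Z - ?u2 i (Z + h))"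
      by (rule has_pd2_diff[OF u has_pd2_shift[OF u]]) (simp add: shift)
    have cont_h: "continuous_on (closure ?H) (\<lambda>Z. u (Z + h))"
      by (rule continuous_on_compose2[OF cont])
         (use h in \<open>auto simp: closure_half_space intro!: continuous_intros\<close>)
    have cont_t: "continuous_on (closure ?H) ?t"
      by (intro continuous_intros cont cont_h)
    have cont_w: "continuous_on UNIV (\<lambda>Z. if Z \<in> ?H then ?w Z else 0)"
      by (intro continuous_on_half_space_extend_0 continuous_on_compose2[OF continuous_on_soft(1)[OF d] cont_t])
         (use d h in \<open>auto simp: bdry soft_eq_0\<close>)
    note w = has_pd2_chain[OF t DERIV_soft[OF d] continuous_on_soft(3)[OF d]]
    have lap_w: "0 \<le> (\<Sum>i\<in>UNIV. soft2 d (?t Z) * (?u1 i Z - ?u1 i (Z + h))\<^sup>2 +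
      soft1 d (?t Z) * (?u2 i Z - ?u2 i (Z + h)))" if Z: "Z \<in> ?H" for Z
    proof -
      \<comment> \<open>Where \<open>soft1\<close> is nonzero, \<open>u\<close> exceeds its
        translate. The negative power reverses this order, and \<open>f\<close> takes the same value
        at both points because \<open>h\<close> is tangential.\<close>
      have "0 \<le> soft1 d (?t Z) * ((\<Sum>i\<in>UNIV. ?u2 i Z) - (\<Sum>i\<in>UNIV. ?u2 i (Z + h)))"
      proof (cases "?t Z \<le> d")
        case False
        then have "u (Z + h) \<le> u Z" using d by simp
        then have "u Z powr (- \<gamma>) \<le> u (Z + h) powr (- \<gamma>)"
          using pos[of "Z + h"] Z \<gamma> by (intro powr_mono2') (auto simp: shift)
        then have "f (Z $ k) * u Z powr (- \<gamma>) \<le> f (Z $ k) * u (Z + h) powr (- \<gamma>)"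
          using f Z by (intro mult_left_mono) (auto simp: half_space_def)
        then show ?thesis
          using lap[of Z] lap[of "Z + h"] Z h soft_bounds(3)[OF d] by (simp add: shift)
      qed (simp add: soft_eq_0)
      moreover have "0 \<le> soft2 d (?t Z) * (\<Sum>i\<in>UNIV. (?u1 i Z - ?u1 i (Z + h))\<^sup>2)"
        using soft_bounds(5)[OF d] by (intro mult_nonneg_nonneg sum_nonneg) auto
      ultimately show ?thesis
        by (simp add: sum.distrib sum_distrib_left[symmetric] sum_subtractf)
    qed
    \<comment> \<open>Closed because the difference is continuous up to the boundary; it misses the
      boundary because the difference is \<open>0 < d\<close> there.\<close>
    define C where "C = closure ?H \<inter> ?t -` {d..}"
    have C: "closed C" "C \<subseteq> ?H" "\<And>Z. Z \<in> ?H - C \<Longrightarrow> ?w Z = 0"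
    proof -
      show "closed C" unfolding C_def
        by (rule continuous_closed_preimage[OF cont_t]) auto
      show "C \<subseteq> ?H"
      proof
        fix Z assume Z: "Z \<in> C"
        then have "0 \<le> Z $ k" "d \<le> ?t Z" by (auto simp: C_def closure_half_space)
        moreover have "Z $ k \<noteq> 0"
          using \<open>d \<le> ?t Z\<close> d bdry[of Z] bdry[of "Z + h"] h by auto
        ultimately show "Z \<in> ?H" by (simp add: half_space_def)
      qed
      show "?w Z = 0" if "Z \<in> ?H - C" for Z
        using that closure_subset[of ?H] by (intro soft_eq_0) (auto simp: C_def)
    qed
    have wv: "?w Z \<le> u Z - c * Z $ k" if Z: "Z \<in> ?H" for Z
    proof -
      have "c * Z $ k \<le> u (Z + h)" using c_le[of "Z + h"] Z h by (simp add: shift)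
      then show ?thesis using soft_bounds(2)[OF d, of "?t Z"] c_le[OF Z] by linarith
    qed
    have lap_v: "(\<Sum>i\<in>UNIV. ?u2 i Z - 0) \<le> 0" if "Z \<in> ?H" for Z
      using lap[OF that] f that by (simp add: half_space_def)
    have Xk: "0 < X $ k" using X by (simp add: half_space_def)
    \<comment> \<open>Chosen so that \<open>boundary_comparison\<close>, divided by
      \<open>Y $ k\<close>, becomes a lower bound \<open>c + \<delta>\<close> for the quotient whose
      infimum is \<open>c\<close>.\<close>
    define \<delta> where "\<delta> = ?w X / (2 ^ (CARD('n) + 4) * X $ k)"
    have "c + \<delta> \<le> u Y / Y $ k" if Y: "Y \<in> ?H" for Y
    proof -
      have Yk: "0 < Y $ k" using Y by (simp add: half_space_def)
      have "?w X * Y $ k \<le> 2 ^ (CARD('n) + 4) * (u Y - c * Y $ k) * X $ k"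
        by (rule boundary_comparison[OF w lap_w cont_w C v lap_v cont_v _ wv X Y]) (use c_le in auto)
      then have "\<delta> * Y $ k \<le> u Y - c * Y $ k"
        unfolding \<delta>_def using Xk by (simp add: field_simps)
      then show ?thesis using Yk by (simp add: field_simps)
    qed
    then have "c + \<delta> \<le> c"
      unfolding c_def[symmetric] using cINF_greatest[OF ne, of "c + \<delta>" "\<lambda>Z. u Z / Z $ k"]
      by (simp add: c_def)
    moreover have q: "0 < 2 ^ (CARD('n) + 4) * X $ k" using Xk by simp
    moreover have "?w X = \<delta> * (2 ^ (CARD('n) + 4) * X $ k)" unfolding \<delta>_def using Xk by simp
    ultimately have "?w X \<le> 0" by (metis add_le_same_cancel1 less_imp_le mult_nonpos_nonneg)
    then show ?thesis
    proof (rule contrapos_pp)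
      assume "\<not> ?t X \<le> d"
      then show "\<not> ?w X \<le> 0"
        using d by (auto simp: soft_def not_le intro!: divide_pos_pos zero_less_power)
    qed
  qed
  show ?thesis
    using le_d by (metis diff_le_0_iff_le field_le_epsilon add_0)
qed

text \<open>Translation by \<open>Y - X\<close> gives one inequality, translation back gives the
  other.\<close>

lemma solution_eq_if_nth_eq:
  assumes sol: "global_solution k \<gamma> f u" and "\<gamma> > 0" "\<And>t. t > 0 \<Longrightarrow> 0 \<le> f t"
    and XY: "X $ k = Y $ k" "X \<in> half_space k"
  shows "u X = u Y"
  using solution_le_translate[OF sol assms(2,3), of "Y - X" X]
    solution_le_translate[OF sol assms(2,3), of "X - Y" Y] XY
  by (simp add: half_space_def)

lemma solution_one_dimensional:
  assumes sol: "global_solution k \<gamma> f u" and "\<gamma> > 0" "\<And>t. t > 0 \<Longrightarrow> 0 \<le> f t"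
  shows "one_dimensional k u"
  unfolding one_dimensional_def
proof (intro exI[of _ "\<lambda>t. u (t *\<^sub>R axis k 1)"] ballI)
  fix X assume X: "X \<in> closure (half_space k)"
  show "u X = u (X $ k *\<^sub>R axis k 1)"
  proof (cases "X $ k = 0")
    case True
    then show ?thesis
      using sol unfolding global_solution_def frontier_half_space by simp
  next
    case False
    with X have "X \<in> half_space k" by (simp add: closure_half_space half_space_def)
    then show ?thesis by (intro solution_eq_if_nth_eq[OF assms]) simp_all
  qed
qed

subsection \<open>The one-dimensional equation\<close>

text \<open>A positive concave function on a half-line is nondecreasing and, from \<open>1\<close>
  on, at most \<open>M * t\<close>. With \<open>\<gamma> \<le> 1\<close> this yields
  \<open>\<phi> t powr (- \<gamma>) \<ge> 1 / (M * t)\<close>, so \<open>\<phi>1\<close> falls at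
  least as fast as a multiple of the logarithm grows and cannot remain nonnegative.\<close>

lemma no_positive_concave_solution:
  fixes \<phi> \<phi>1 \<phi>2 :: "real \<Rightarrow> real"
  assumes d1: "\<And>t. t > 0 \<Longrightarrow> (\<phi> has_real_derivative \<phi>1 t) (at t)"
    and d2: "\<And>t. t > 0 \<Longrightarrow> (\<phi>1 has_real_derivative \<phi>2 t) (at t)"
    and pos: "\<And>t. t > 0 \<Longrightarrow> 0 < \<phi> t"
    and le: "\<And>t. t > 0 \<Longrightarrow> \<phi>2 t \<le> - (lam * \<phi> t powr (- \<gamma>))"
    and lam: "0 < lam" and \<gamma>: "0 < \<gamma>" "\<gamma> \<le> 1"
  shows False
proof -
  have "\<phi>2 t \<le> 0" if "t > 0" for t
  proof -
    have "0 \<le> lam * \<phi> t powr (- \<gamma>)" using lam by simp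
    then show ?thesis using le[OF that] by linarith
  qed
  then have dec: "\<phi>1 t \<le> \<phi>1 s" if "0 < s" "s \<le> t" for s t
    using that d2 by (intro DERIV_nonpos_imp_nonincreasing[OF that(2)]) (meson less_le_trans)
  have tangent: "\<phi> t \<le> \<phi> s + \<phi>1 s * (t - s)" if "0 < s" "s \<le> t" for s t
  proof -
    have "\<phi> t - \<phi>1 s * t \<le> \<phi> s - \<phi>1 s * s"
    proof (rule DERIV_nonpos_imp_nonincreasing[OF that(2)])
      fix x assume x: "s \<le> x" "x \<le> t"
      have "((\<lambda>t. \<phi> t - \<phi>1 s * t) has_real_derivative (\<phi>1 x - \<phi>1 s)) (at x)"
        using d1[of x] x that by (auto intro!: derivative_eq_intros)
      then show "\<exists>y. ((\<lambda>t. \<phi> t - \<phi>1 s * t) has_real_derivative y) (at x) \<and> y \<le> 0"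
        using dec[of s x] x that by (intro exI conjI) auto
    qed
    then show ?thesis by (simp add: algebra_simps)
  qed
  have nonneg: "0 \<le> \<phi>1 s" if "0 < s" for s
  proof (rule ccontr)
    assume neg: "\<not> 0 \<le> \<phi>1 s"
    \<comment> \<open>The zero of the tangent line at \<open>s\<close>.\<close>
    define t where "t = s + \<phi> s / (- \<phi>1 s)"
    have "s \<le> t" using neg pos[OF that] by (simp add: t_def divide_nonneg_neg divide_nonneg_nonpos divide_nonpos_neg divide_le_0_iff)
    then have "\<phi> t \<le> \<phi> s + \<phi>1 s * (t - s)" by (rule tangent[OF that])
    also have "\<dots> = 0" using neg by (simp add: t_def)
    finally show False using pos[of t] \<open>s \<le> t\<close> that by simp
  qed
  \<comment> \<open>The summand \<open>1\<close> ensures \<open>M * t \<ge> 1\<close> for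
    \<open>t \<ge> 1\<close>, so that \<open>\<gamma> \<le> 1\<close> gives
    \<open>(M * t) powr (- 1) \<le> (M * t) powr (- \<gamma>)\<close>.\<close>
  define M where "M = 1 + \<phi> 1 + \<phi>1 1"
  have M: "1 \<le> M" "\<phi> 1 \<le> M" "\<phi>1 1 \<le> M" using pos[of 1] nonneg[of 1] by (simp_all add: M_def)
  have upper: "\<phi>2 t \<le> - (lam / M / t)" if t: "1 \<le> t" for t
  proof -
    have "\<phi> t \<le> \<phi> 1 + \<phi>1 1 * (t - 1)" using tangent[of 1 t] t by simp
    also have "\<dots> \<le> M * 1 + M * (t - 1)" using t M pos[of 1] by (intro add_mono mult_right_mono) auto
    finally have Mt: "\<phi> t \<le> M * t" by (simp add: algebra_simps)
    have Mt1: "1 \<le> M * t" using M t by (metis mult_mono' mult_1 zero_le_one)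
    have "1 / (M * t) = (M * t) powr (- 1)" using Mt1 by (simp add: powr_minus_divide)
    also have "\<dots> \<le> (M * t) powr (- \<gamma>)" using Mt1 \<gamma> by (intro powr_mono) auto
    also have "\<dots> \<le> \<phi> t powr (- \<gamma>)" using Mt pos[of t] t \<gamma> by (intro powr_mono2') auto
    finally have "lam * (1 / (M * t)) \<le> lam * \<phi> t powr (- \<gamma>)" using lam by (intro mult_left_mono) auto
    then show ?thesis using le[of t] t by simp
  qed
  \<comment> \<open>Solves \<open>lam / M * ln T = \<phi>1 1 + 1\<close>, which drives
    \<open>\<phi>1 T\<close> down to at most \<open>- 1\<close>.\<close>
  define T where "T = exp (M * (\<phi>1 1 + 1) / lam)"
  have T: "1 \<le> T" using M nonneg[of 1] lam by (simp add: T_def)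
  have "\<phi>1 T + lam / M * ln T \<le> \<phi>1 1 + lam / M * ln 1"
  proof (rule DERIV_nonpos_imp_nonincreasing[OF T])
    fix x :: real assume x: "1 \<le> x" "x \<le> T"
    have "((\<lambda>t. \<phi>1 t + lam / M * ln t) has_real_derivative (\<phi>2 x + lam / M / x)) (at x)"
      using d2[of x] x M(1) by (auto intro!: derivative_eq_intros simp: field_simps)
    then show "\<exists>y. ((\<lambda>t. \<phi>1 t + lam / M * ln t) has_real_derivative y) (at x) \<and> y \<le> 0"
      using upper[OF x(1)] by (intro exI conjI) auto
  qed
  moreover have "lam / M * ln T = \<phi>1 1 + 1" using M lam by (simp add: T_def)
  ultimately have "\<phi>1 T \<le> - 1" by simp
  then show False using nonneg[of T] T by simp
qed

section \<open>Reduction to the one-dimensional equation and conclusion\<close>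

lemma partial_deriv_eq_0:
  assumes S: "open S" "X \<in> S" and u: "u differentiable at X"
    and const: "\<And>Y. Y \<in> S \<Longrightarrow> (\<And>j. j \<noteq> i \<Longrightarrow> Y $ j = X $ j) \<Longrightarrow> u Y = u X"
  shows "partial_deriv i u X = 0"
proof -
  have "open ((\<lambda>t. X + t *\<^sub>R axis i (1::real)) -` S)"
    by (intro continuous_open_vimage S continuous_intros)
  then have "\<forall>\<^sub>F t in nhds 0. t \<in> (\<lambda>t. X + t *\<^sub>R axis i (1::real)) -` S"
    by (rule eventually_nhds_in_open) (simp add: S)
  then have "\<forall>\<^sub>F t in nhds 0. u (X + t *\<^sub>R axis i 1) = u X"
    by eventually_elim (rule const, auto simp: axis_def)
  from DERIV_cong_ev[OF refl this refl] have "has_pd i u 0 X"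
    unfolding has_pd_def by simp
  then show ?thesis
    using has_pd_unique[OF has_pd_partial_deriv[OF u]] by blast
qed

text \<open>By symmetry all pure second derivatives except the one in direction \<open>k\<close>
  vanish, so the restriction of \<open>u\<close> to the axis satisfies the differential inequality
  of \<open>no_positive_concave_solution\<close>.\<close>

lemma no_solution:
  assumes sol: "global_solution k \<gamma> f u" and \<gamma>: "0 < \<gamma>" "\<gamma> \<le> 1"
    and f: "\<And>t. t > 0 \<Longrightarrow> lam \<le> f t" and lam: "0 < lam"
  shows False
proof -
  have f0: "0 \<le> f t" if "t > 0" for t using f[OF that] lam by simp
  have C2: "C2_on (half_space k) u" using sol by (simp add: global_solution_def)
  have u: "has_pd2 (half_space k) u (\<lambda>i. partial_deriv i u) (\<lambda>i. partial_deriv i (partial_deriv i u))"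
    by (rule C2_on_imp_has_pd2[OF C2])
  have ui: "partial_deriv i u Z = 0" if "Z \<in> half_space k" "i \<noteq> k" for i Z
  proof (rule partial_deriv_eq_0[OF open_half_space that(1)])
    show "u differentiable at Z" using C2 that by (simp add: C2_on_def C1_on_def)
    fix Y assume "Y \<in> half_space k" "\<And>j. j \<noteq> i \<Longrightarrow> Y $ j = Z $ j"
    then show "u Y = u Z"
      using that(2) by (intro solution_eq_if_nth_eq[OF sol \<gamma>(1) f0]) auto
  qed
  have uii: "partial_deriv i (partial_deriv i u) Z = 0" if "Z \<in> half_space k" "i \<noteq> k" for i Z
    by (rule partial_deriv_eq_0[OF open_half_space that(1)])
       (use C2 that ui in \<open>auto simp: C2_on_def C1_on_def\<close>)
  have lap: "laplacian u Z = partial_deriv k (partial_deriv k u) Z" if "Z \<in> half_space k" for Z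
  proof -
    have "(\<Sum>i\<in>UNIV. partial_deriv i (partial_deriv i u) Z) = (\<Sum>i\<in>{k}. partial_deriv i (partial_deriv i u) Z)"
      by (rule sum.mono_neutral_right) (use uii[OF that] in auto)
    then show ?thesis by (simp add: laplacian_def)
  qed
  let ?L = "\<lambda>t. t *\<^sub>R axis k (1::real)"
  have L: "?L t \<in> half_space k" if "t > 0" for t using that by (simp add: half_space_def)
  show False
  proof (rule no_positive_concave_solution[OF _ _ _ _ lam \<gamma>])
    fix t :: real assume t: "t > 0"
    show "((\<lambda>t. u (?L t)) has_real_derivative partial_deriv k u (?L t)) (at t)"
      using has_pd_line[of k u _ 0 t] has_pd2D(4)[OF u L[OF t]] by simp
    show "((\<lambda>t. partial_deriv k u (?L t)) has_real_derivative partial_deriv k (partial_deriv k u) (?L t)) (at t)"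
      using has_pd_line[of k "partial_deriv k u" _ 0 t] has_pd2D(5)[OF u L[OF t]] by simp
    show "0 < u (?L t)" using sol L[OF t] by (simp add: global_solution_def)
    have "- laplacian u (?L t) = f (?L t $ k) * u (?L t) powr (- \<gamma>)"
      using sol L[OF t] unfolding global_solution_def by blast
    then have "partial_deriv k (partial_deriv k u) (?L t) = - (f t * u (?L t) powr (- \<gamma>))"
      using lap[OF L[OF t]] by simp
    also have "\<dots> \<le> - (lam * u (?L t) powr (- \<gamma>))"
      using f[OF t] by (simp add: mult_right_mono)
    finally show "partial_deriv k (partial_deriv k u) (?L t) \<le> - (lam * u (?L t) powr (- \<gamma>))" .
  qed
qed

theorem corollary1p1:
  fixes k :: "'n::finite" and \<gamma> lam Lam :: real and f :: "real \<Rightarrow> real"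
  assumes "CARD('n) \<ge> 2"
    and "\<gamma> > 0"
    and "0 < lam" and "lam \<le> Lam"
    and "locally_Dini_continuous f"
    and "\<And>t. t > 0 \<Longrightarrow> f t \<in> {lam..Lam}"
  shows "(\<gamma> > 1 \<longrightarrow> (\<forall>u. global_solution k \<gamma> f u \<longrightarrow> one_dimensional k u)) \<and>
         (\<gamma> \<le> 1 \<longrightarrow> \<not> (\<exists>u. global_solution k \<gamma> f u))"
proof (intro conjI impI allI)
  have f: "lam \<le> f t" "0 \<le> f t" if "t > 0" for t
    using assms(6)[OF that] \<open>0 < lam\<close> by auto
  show "one_dimensional k u" if "global_solution k \<gamma> f u" for u
    using solution_one_dimensional[OF that \<open>\<gamma> > 0\<close> f(2)] .
  show "\<not> (\<exists>u. global_solution k \<gamma> f u)" if "\<gamma> \<le> 1"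
    using no_solution[of k \<gamma> f _ lam] \<open>\<gamma> > 0\<close> that f(1) \<open>0 < lam\<close> by blast
qed

end
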